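(* Let $s\in(1,2]$, let $\alpha$ be a cardinal number with $\alpha\geq\aleph_0$, and let $p\in\{1,2\}$. Then the set $H_s[0,1]=\{f\in C[0,1]:\dim_H G_f([0,1])=s\}$ is $(p,\mathfrak{c})$-spaceable in $C[0,1]$, but it is not $(\alpha,\beta)$-spaceable for any cardinal number $\beta$.
   Context: $C[0,1]$ is the real Banach space of real-valued continuous functions on $[0,1]$ with the maximum norm. For a function $f$ defined on $X\subseteq\mathbb{R}$, $G_f(X)=\{(x,f(x)):x\in X\}$ is its graph over $X$, and $\dim_H$ denotes Hausdorff dimension. $\mathfrak{c}$ is the cardinality of $\mathbb{R}$ and $\aleph_0$ that of $\mathbb{N}$. For cardinals $\alpha<\beta$, a subset $A$ of a topological vector space $X$ is called $\alpha$-lineable if there is an $\alpha$-dimensional linear subspace $M$ with $M\subseteq A\cup\{0\}$; it is called $(\alpha,\beta)$-spaceable if it is $\alpha$-lineable and for every $\alpha$-dimensional subspace $W_\alpha\subseteq A\cup\{0\}$ there is a closed $\beta$-dimensional subspace $W_\beta$ with $W_\alpha\subseteq W_\beta\subseteq A\cup\{0\}$. *)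

theory Defs
  imports "HOL-Analysis.Analysis" "HOL-Library.Function_Algebras" "HOL-Library.Equipollence"
begin

text \<open>Elements of C[0,1] are represented as functions real => real that are continuous
  on [0,1] and vanish outside [0,1] (a canonical representative, so that the
  vector operations are the pointwise ones on the function type).\<close>

definition C01 :: "(real \<Rightarrow> real) set" where
  "C01 = {f. continuous_on {0..1} f \<and> (\<forall>x. x \<notin> {0..1} \<longrightarrow> f x = 0)}"

definition fscale :: "real \<Rightarrow> (real \<Rightarrow> real) \<Rightarrow> (real \<Rightarrow> real)" where
  "fscale c f = (\<lambda>x. c * f x)"

lemma module_fscale: "module fscale"
  by unfold_locales (auto simp: fscale_def fun_eq_iff algebra_simps)

definition lin_subspace :: "(real \<Rightarrow> real) set \<Rightarrow> bool" where
  "lin_subspace M \<longleftrightarrow> M \<subseteq> C01 \<and> module.subspace fscale M"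

definition has_dim :: "(real \<Rightarrow> real) set \<Rightarrow> 'a set \<Rightarrow> bool" where
  "has_dim M A \<longleftrightarrow> (\<exists>B. B \<subseteq> M \<and> \<not> module.dependent fscale B
                        \<and> module.span fscale B = M \<and> B \<approx> A)"

definition closed_C01 :: "(real \<Rightarrow> real) set \<Rightarrow> bool" where
  "closed_C01 M \<longleftrightarrow> (\<forall>g f. (\<forall>n. g n \<in> M) \<and> f \<in> C01 \<and> uniform_limit {0..1} g f sequentially
                         \<longrightarrow> f \<in> M)"

definition lineable :: "(real \<Rightarrow> real) set \<Rightarrow> 'a set \<Rightarrow> bool" where
  "lineable S A \<longleftrightarrow> (\<exists>M. lin_subspace M \<and> has_dim M A \<and> M \<subseteq> S \<union> {0})"

definition spaceable :: "(real \<Rightarrow> real) set \<Rightarrow> 'a set \<Rightarrow> 'b set \<Rightarrow> bool" where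
  "spaceable S A B \<longleftrightarrow> lineable S A \<and>
     (\<forall>W. lin_subspace W \<and> has_dim W A \<and> W \<subseteq> S \<union> {0} \<longrightarrow>
        (\<exists>V. lin_subspace V \<and> closed_C01 V \<and> has_dim V B \<and> W \<subseteq> V \<and> V \<subseteq> S \<union> {0}))"

definition hausdorff_pre :: "real \<Rightarrow> real \<Rightarrow> 'a::metric_space set \<Rightarrow> ennreal" where
  "hausdorff_pre s \<delta> E =
     (INF U \<in> {U :: nat \<Rightarrow> 'a set. (\<forall>i. bounded (U i) \<and> diameter (U i) \<le> \<delta>) \<and> E \<subseteq> (\<Union>i. U i)}.
        (\<Sum>i. ennreal (diameter (U i) powr s)))"

definition hausdorff_measure :: "real \<Rightarrow> 'a::metric_space set \<Rightarrow> ennreal" where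
  "hausdorff_measure s E = (SUP \<delta> \<in> {0<..}. hausdorff_pre s \<delta> E)"

definition hausdorff_dim :: "'a::metric_space set \<Rightarrow> real" where
  "hausdorff_dim E = Inf {s. 0 \<le> s \<and> hausdorff_measure s E = 0}"

definition graph01 :: "(real \<Rightarrow> real) \<Rightarrow> (real \<times> real) set" where
  "graph01 f = (\<lambda>x. (x, f x)) ` {0..1}"

definition H_s :: "real \<Rightarrow> (real \<Rightarrow> real) set" where
  "H_s s = {f \<in> C01. hausdorff_dim (graph01 f) = s}"

end

theory Submission
  imports Defs "HOL-Real_Asymp.Real_Asymp" "HOL-Computational_Algebra.Polynomial"
begin

text \<open>Negative part: given a subspace \<open>M \<subseteq> H_s \<union> {0}\<close> of infinite dimension, take a linear
  functional \<open>l\<close> on \<open>M\<close> that is unbounded. Adding a Lipschitz function does not change the dimension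
  of a graph, so \<open>{g + l(g) x : g \<in> M}\<close> is again contained in \<open>H_s \<union> {0}\<close> and has the same dimension
  as \<open>M\<close>, but its closure contains the function \<open>x\<close>, whose graph has dimension 1.

  Positive part: let \<open>W\<close> be finite-dimensional. All \<open>w \<in> W\<close> share a modulus of continuity, and one
  constructs a Cantor set of dimension \<open>s - 1\<close>, very sparse relative to this modulus, with Cantor
  function \<open>\<Phi>\<close>. For any continuous \<open>Z\<close> the graph of \<open>w + Z \<circ> \<Phi>\<close> has dimension at most \<open>s\<close>: off the Cantor
  set it is locally a translate of the graph of \<open>w\<close>, and over the Cantor set every graph has dimension
  at most \<open>1 + (s - 1)\<close>. If \<open>Z\<close> is a nonzero multiple of a series of triangle waves
  \<open>\<Sum>n. 2\<^bsup>-n\<^sup>2\<^esup> tri(M n u)\<close> on some interval, its oscillation on the Cantor set dominates that of every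
  \<open>w\<close> at all small scales, and counting cells gives dimension at least \<open>s\<close>. Such series supported on
  infinitely many disjoint intervals span the closed space that is added to \<open>W\<close>.\<close>

subsection \<open>Sets of Hausdorff measure zero\<close>

text \<open>The graph of a sum can have larger dimension than both summands, and \<open>w\<close>
  may cancel the oscillation of what is added to it. Hence the scales \<open>M\<close> are chosen
  after \<open>W\<close>, against a common modulus of a finite basis of \<open>W\<close>. The lower
  bound is a mass distribution argument on the parameter interval of the Cantor set: a covering set
  of diameter \<open>r\<close> with \<open>rho (n+1) \<le> r < rho n\<close> meets a fraction of
  roughly \<open>r powr (s - 1)\<close> of the cells of level \<open>n+1\<close>. At each further
  level \<open>l\<close> with \<open>amp (l+1) \<ge> r\<close>, the wave of height
  \<open>amp l\<close> lets only a fraction of about \<open>amp (l+1) / amp l\<close> of the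
  subcells stay inside; telescoping down to an amplitude close to \<open>r\<close> contributes one
  more factor \<open>r\<close>. The parameters caught have measure about \<open>r powr s\<close>,
  and the losses are absorbed by any \<open>t < s\<close>. Closedness of the final space comes from
  adding finitely many dimensions to a closed space.\<close>

definition hnull :: "real \<Rightarrow> 'a::metric_space set \<Rightarrow> bool" where
  "hnull t E \<longleftrightarrow> (\<forall>d>0. \<forall>e>0. \<exists>U :: nat \<Rightarrow> 'a set.
     (\<forall>i. bounded (U i) \<and> diameter (U i) \<le> d) \<and> E \<subseteq> (\<Union>i. U i) \<and>
     (\<Sum>i. ennreal (diameter (U i) powr t)) < ennreal e)"

text \<open>Only the exponents of measure zero enter \<open>hausdorff_dim\<close>, so suprema and
  infima of extended reals can be traded for one epsilon condition.\<close>

lemma hausdorff_measure_eq_0_iff: "hausdorff_measure t E = 0 \<longleftrightarrow> hnull t E"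
proof -
  have pre0: "hausdorff_pre t d E = 0 \<longleftrightarrow> (\<forall>e>0. \<exists>U :: nat \<Rightarrow> 'a set.
     (\<forall>i. bounded (U i) \<and> diameter (U i) \<le> d) \<and> E \<subseteq> (\<Union>i. U i) \<and>
     (\<Sum>i. ennreal (diameter (U i) powr t)) < ennreal e)" (is "_ \<longleftrightarrow> ?R") for d
  proof
    assume *: "hausdorff_pre t d E = 0"
    show ?R
    proof (intro allI impI)
      fix e :: real assume "0 < e"
      then have "hausdorff_pre t d E < ennreal e" using * by simp
      then show "\<exists>U :: nat \<Rightarrow> 'a set. (\<forall>i. bounded (U i) \<and> diameter (U i) \<le> d) \<and> E \<subseteq> (\<Union>i. U i) \<and>
          (\<Sum>i. ennreal (diameter (U i) powr t)) < ennreal e"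
        unfolding hausdorff_pre_def INF_less_iff by blast
    qed
  next
    assume R: ?R
    have "hausdorff_pre t d E \<le> 0"
    proof (rule ennreal_le_epsilon)
      fix e :: real assume "0 < e"
      with R have "hausdorff_pre t d E < ennreal e"
        unfolding hausdorff_pre_def INF_less_iff by blast
      then show "hausdorff_pre t d E \<le> 0 + ennreal e" by simp
    qed
    then show "hausdorff_pre t d E = 0" by simp
  qed
  have "hausdorff_measure t E = 0 \<longleftrightarrow> (\<forall>d>0. hausdorff_pre t d E = 0)"
  proof
    assume *: "hausdorff_measure t E = 0"
    show "\<forall>d>0. hausdorff_pre t d E = 0"
    proof (intro allI impI)
      fix d :: real assume "d > 0"
      then have "hausdorff_pre t d E \<le> hausdorff_measure t E"
        unfolding hausdorff_measure_def by (intro SUP_upper) auto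
      with * show "hausdorff_pre t d E = 0" by simp
    qed
  next
    assume *: "\<forall>d>0. hausdorff_pre t d E = 0"
    have "hausdorff_measure t E \<le> 0"
      unfolding hausdorff_measure_def using * by (intro SUP_least) auto
    then show "hausdorff_measure t E = 0" by simp
  qed
  then show ?thesis by (simp add: pre0 hnull_def)
qed

lemma hausdorff_dim_altdef: "hausdorff_dim E = Inf {t. 0 \<le> t \<and> hnull t E}"
  by (simp add: hausdorff_dim_def hausdorff_measure_eq_0_iff)

lemma hnull_subset: "hnull t E \<Longrightarrow> F \<subseteq> E \<Longrightarrow> hnull t F"
  unfolding hnull_def by (meson subset_trans)

lemma hnull_mono:
  assumes "hnull t E" "t \<le> t'"
  shows "hnull t' E"
  unfolding hnull_def
proof (intro allI impI)
  fix d e :: real assume "d > 0" "e > 0"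
  \<comment> \<open>Diameters at most 1 make the powers decrease when the exponent grows.\<close>
  then have "min d 1 > 0" by simp
  from assms(1)[unfolded hnull_def, rule_format, OF this \<open>e > 0\<close>]
  obtain U where U: "\<And>i. bounded (U i)" "\<And>i. diameter (U i) \<le> min d 1"
      "E \<subseteq> (\<Union>i. U i)" "(\<Sum>i. ennreal (diameter (U i) powr t)) < ennreal e"
    by blast
  have "diameter (U i) powr t' \<le> diameter (U i) powr t" for i
  proof (cases "diameter (U i) = 0")
    case False
    then have "0 < diameter (U i)" using diameter_ge_0[OF U(1)] by (simp add: less_le)
    then show ?thesis using U(2)[of i] assms(2) by (intro powr_mono') auto
  qed simp
  then have "(\<Sum>i. ennreal (diameter (U i) powr t')) \<le> (\<Sum>i. ennreal (diameter (U i) powr t))"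
    by (intro suminf_le) (auto intro: ennreal_leI)
  with U show "\<exists>U. (\<forall>i. bounded (U i) \<and> diameter (U i) \<le> d) \<and> E \<subseteq> (\<Union>i. U i) \<and>
      (\<Sum>i. ennreal (diameter (U i) powr t')) < ennreal e"
    by (intro exI[of _ U]) (auto intro: le_less_trans)
qed

lemma diameter_leI:
  assumes "0 \<le> d" "\<And>x y. x \<in> S \<Longrightarrow> y \<in> S \<Longrightarrow> dist x y \<le> d"
  shows "diameter S \<le> d"
  using assms unfolding diameter_def by (auto intro!: cSUP_least)

lemma hnull_lipschitz_image:
  fixes h :: "'a::metric_space \<Rightarrow> 'b::metric_space"
  assumes null: "hnull t E" and C: "C > 0" and "0 \<le> t"
    and lip: "\<And>x y. x \<in> E \<Longrightarrow> y \<in> E \<Longrightarrow> dist (h x) (h y) \<le> C * dist x y"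
  shows "hnull t (h ` E)"
  unfolding hnull_def
proof (intro allI impI)
  fix d e :: real assume "d > 0" "e > 0"
  then have "d / C > 0" "e / C powr t > 0" using C by auto
  then obtain U where U: "\<And>i. bounded (U i)" "\<And>i. diameter (U i) \<le> d / C"
      "E \<subseteq> (\<Union>i. U i)" "(\<Sum>i. ennreal (diameter (U i) powr t)) < ennreal (e / C powr t)"
    using null unfolding hnull_def by metis
  \<comment> \<open>The Lipschitz bound holds on \<open>E\<close> only, so each covering set is cut
    down to \<open>E\<close> before it is mapped.\<close>
  define V where "V i = h ` (U i \<inter> E)" for i
  have dV: "dist x y \<le> C * diameter (U i)" if xy: "x \<in> V i" "y \<in> V i" for x y i
  proof -
    obtain x' y' where *: "x' \<in> U i" "x' \<in> E" "y' \<in> U i" "y' \<in> E" "x = h x'" "y = h y'"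
      using xy unfolding V_def by blast
    have "dist x y \<le> C * dist x' y'" using lip * by simp
    also have "\<dots> \<le> C * diameter (U i)"
      using * C diameter_bounded_bound[OF U(1), of x' i y'] by (intro mult_left_mono) auto
    finally show ?thesis .
  qed
  have nn: "0 \<le> diameter (U i)" for i by (rule diameter_ge_0[OF U(1)])
  have bV: "bounded (V i)" for i
    unfolding bounded_two_points using dV by blast
  have dV': "diameter (V i) \<le> C * diameter (U i)" for i
    using dV nn C by (intro diameter_leI) auto
  have "ennreal (diameter (V i) powr t) \<le> ennreal (C powr t) * ennreal (diameter (U i) powr t)" for i
  proof -
    have "diameter (V i) powr t \<le> (C * diameter (U i)) powr t"
      using dV' diameter_ge_0[OF bV] \<open>0 \<le> t\<close> by (intro powr_mono2) auto
    also have "\<dots> = C powr t * diameter (U i) powr t" using C nn by (simp add: powr_mult)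
    finally show ?thesis by (simp add: ennreal_mult'[symmetric] ennreal_leI)
  qed
  then have "(\<Sum>i. ennreal (diameter (V i) powr t)) \<le> (\<Sum>i. ennreal (C powr t) * ennreal (diameter (U i) powr t))"
    by (intro suminf_le) auto
  also have "\<dots> = ennreal (C powr t) * (\<Sum>i. ennreal (diameter (U i) powr t))"
    by simp
  also have "\<dots> < ennreal (C powr t) * ennreal (e / C powr t)"
    using U(4) C by (intro ennreal_mult_strict_left_mono) auto
  also have "\<dots> = ennreal e"
    using C by (simp add: ennreal_mult'[symmetric])
  finally have "(\<Sum>i. ennreal (diameter (V i) powr t)) < ennreal e" .
  moreover have "diameter (V i) \<le> d" for i
    using dV'[of i] U(2)[of i] C by (simp add: field_simps)
  moreover have "h ` E \<subseteq> (\<Union>i. V i)" using U(3) unfolding V_def by blast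
  ultimately show "\<exists>V. (\<forall>i. bounded (V i) \<and> diameter (V i) \<le> d) \<and> h ` E \<subseteq> (\<Union>i. V i) \<and>
      (\<Sum>i. ennreal (diameter (V i) powr t)) < ennreal e"
    using bV by blast
qed

lemma hnull_UN:
  fixes E :: "nat \<Rightarrow> 'a::metric_space set"
  assumes "\<And>n. hnull t (E n)"
  shows "hnull t (\<Union>n. E n)"
  unfolding hnull_def
proof (intro allI impI)
  fix d e :: real assume "d > 0" "e > 0"
  \<comment> \<open>Summing gives only \<open>\<le> e / 2\<close>; the spare half keeps the
    inequality with \<open>e\<close> strict.\<close>
  then have "\<forall>n. \<exists>U. (\<forall>i. bounded (U i) \<and> diameter (U i) \<le> d) \<and> E n \<subseteq> (\<Union>i. U i) \<and>
      (\<Sum>i. ennreal (diameter (U i) powr t)) < ennreal (e / 2 * (1/2) ^ Suc n)"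
    using assms unfolding hnull_def by auto
  then obtain U where U: "\<And>n i. bounded (U n i)" "\<And>n i. diameter (U n i) \<le> d"
      "\<And>n. E n \<subseteq> (\<Union>i. U n i)"
      "\<And>n. (\<Sum>i. ennreal (diameter (U n i) powr t)) < ennreal (e / 2 * (1/2) ^ Suc n)"
    by metis
  define V where "V k = (case prod_decode k of (n, i) \<Rightarrow> U n i)" for k
  have "(\<Sum>k. ennreal (diameter (V k) powr t)) = (\<Sum>n. \<Sum>i. ennreal (diameter (U n i) powr t))"
    unfolding V_def
    by (subst suminf_ennreal_2dimen[where f = "\<lambda>(n, i). ennreal (diameter (U n i) powr t)", symmetric])
      (simp_all add: case_prod_unfold)
  also have "\<dots> \<le> (\<Sum>n. ennreal (e / 2 * (1/2) ^ Suc n))"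
    using U(4) by (intro suminf_le) (auto intro: less_imp_le)
  also have "\<dots> = ennreal (e / 2)"
  proof (rule suminf_ennreal_eq)
    show "(\<lambda>n. e / 2 * (1/2) ^ Suc n) sums (e / 2)"
      using sums_mult[OF power_half_series, of "e / 2"] by simp
  qed (use \<open>e > 0\<close> in simp)
  also have "\<dots> < ennreal e" using \<open>e > 0\<close> by (simp add: ennreal_less_iff)
  finally have "(\<Sum>k. ennreal (diameter (V k) powr t)) < ennreal e" .
  moreover have "(\<Union>n. E n) \<subseteq> (\<Union>k. V k)"
  proof safe
    fix x n assume "x \<in> E n"
    then obtain i where "x \<in> U n i" using U(3) by blast
    then have "x \<in> V (prod_encode (n, i))" by (simp add: V_def)
    then show "x \<in> (\<Union>k. V k)" by blast
  qed
  moreover have "\<forall>k. bounded (V k) \<and> diameter (V k) \<le> d"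
    using U by (auto simp: V_def split: prod.split)
  ultimately show "\<exists>V. (\<forall>i. bounded (V i) \<and> diameter (V i) \<le> d) \<and> (\<Union>n. E n) \<subseteq> (\<Union>i. V i) \<and>
      (\<Sum>i. ennreal (diameter (V i) powr t)) < ennreal e"
    by blast
qed

lemma hnull_countable_UN:
  assumes "countable I" "\<And>i. i \<in> I \<Longrightarrow> hnull t (E i)"
  shows "hnull t (\<Union>i\<in>I. E i)"
proof (cases "I = {}")
  case True
  have "hnull t {}" unfolding hnull_def by (auto intro!: exI[of _ "\<lambda>_. {}"])
  then show ?thesis using True by simp
next
  case False
  then have "(\<Union>i\<in>I. E i) = (\<Union>n. E (from_nat_into I n))"
    using range_from_nat_into[OF False assms(1)] by (metis image_image)
  then show ?thesis
    using hnull_UN[of t "\<lambda>n. E (from_nat_into I n)"] assms(2) from_nat_into[OF False] by simp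
qed

lemma hnull_Un:
  assumes "hnull t E" "hnull t F"
  shows "hnull t (E \<union> F)"
proof -
  have "hnull t (\<Union>i\<in>{True, False}. if i then E else F)"
    by (rule hnull_countable_UN) (use assms in simp_all)
  then show ?thesis by (simp add: Un_commute)
qed

lemma hnull_finite_cover:
  assumes "\<And>d e. d > 0 \<Longrightarrow> e > 0 \<Longrightarrow> \<exists>N (U :: nat \<Rightarrow> 'a::metric_space set). 
     (\<forall>i<N. bounded (U i) \<and> diameter (U i) \<le> d) \<and> E \<subseteq> (\<Union>i<N. U i) \<and>
     (\<Sum>i<N. diameter (U i) powr t) < e"
  shows "hnull t E"
  unfolding hnull_def
proof (intro allI impI)
  fix d e :: real assume de: "d > 0" "e > 0"
  then obtain N and U :: "nat \<Rightarrow> 'a set" where U: "\<And>i. i < N \<Longrightarrow> bounded (U i)"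
     "\<And>i. i < N \<Longrightarrow> diameter (U i) \<le> d" "E \<subseteq> (\<Union>i<N. U i)" "(\<Sum>i<N. diameter (U i) powr t) < e"
    using assms by metis
  \<comment> \<open>Empty sets have diameter 0 and cost \<open>0 powr t = 0\<close>, even for
    \<open>t = 0\<close>, so a finite cover extends to a sequence for free.\<close>
  define V where "V i = (if i < N then U i else {})" for i
  have "(\<Sum>i. ennreal (diameter (V i) powr t)) = (\<Sum>i<N. ennreal (diameter (V i) powr t))"
    by (intro suminf_finite) (auto simp: V_def)
  also have "\<dots> = ennreal (\<Sum>i<N. diameter (U i) powr t)"
    by (simp add: V_def)
  also have "\<dots> < ennreal e" using U(4) de by (simp add: ennreal_less_iff sum_nonneg)
  finally have "(\<Sum>i. ennreal (diameter (V i) powr t)) < ennreal e" .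
  moreover have "E \<subseteq> (\<Union>i. V i)" using U(3) by (force simp: V_def)
  moreover have "\<forall>i. bounded (V i) \<and> diameter (V i) \<le> d" using U de by (auto simp: V_def)
  ultimately show "\<exists>V. (\<forall>i. bounded (V i) \<and> diameter (V i) \<le> d) \<and> E \<subseteq> (\<Union>i. V i) \<and>
      (\<Sum>i. ennreal (diameter (V i) powr t)) < ennreal e"
    by blast
qed

lemma dist_prod_le: "dist x y \<le> dist (fst x) (fst y) + dist (snd x) (snd y)"
  for x y :: "'a::metric_space \<times> 'b::metric_space"
  by (simp add: dist_prod_def sqrt_sum_squares_le_sum)

text \<open>The sum bounds the \<^term>\<open>t\<close>-th powers of the diameters of the squares of side \<^term>\<open>\<rho>\<close>
  needed to cover the strip over \<^term>\<open>N\<close> intervals of length \<^term>\<open>\<rho>\<close>.\<close>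

lemma hnull_strip:
  fixes K :: "real set" and b t :: real
  assumes "0 \<le> b" "0 \<le> t"
    and cover: "\<And>d e. d > 0 \<Longrightarrow> e > 0 \<Longrightarrow> \<exists>(N::nat) \<rho> p. 0 < \<rho> \<and> 2 * \<rho> \<le> d \<and> K \<subseteq> (\<Union>i<N. {p i..p i + \<rho>})
        \<and> real N * (2 * b / \<rho> + 1) * (2 * \<rho>) powr t < e"
  shows "hnull t (K \<times> {-b..b})"
proof (rule hnull_finite_cover)
  fix d e :: real assume "d > 0" "e > 0"
  from cover[OF this] obtain N :: nat and \<rho> p where h: "0 < \<rho>" "2 * \<rho> \<le> d"
      "K \<subseteq> (\<Union>i<N. {p i..p i + \<rho>})" "real N * (2 * b / \<rho> + 1) * (2 * \<rho>) powr t < e"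
    by blast
  \<comment> \<open>\<open>L\<close> squares of side \<open>\<rho>\<close> fill the height
    \<open>2 * b\<close> of a column; below, \<open>i div L\<close> is the column and
    \<open>i mod L\<close> the square in it.\<close>
  define L where "L = nat \<lfloor>2 * b / \<rho>\<rfloor> + 1"
  have L: "real L \<le> 2 * b / \<rho> + 1" "L > 0"
    using h(1) assms(1) by (auto simp: L_def)
  define U where "U i = {p (i div L)..p (i div L) + \<rho>} \<times> {-b + (i mod L) * \<rho>..-b + (i mod L) * \<rho> + \<rho>}" for i
  have dU: "dist x y \<le> 2 * \<rho>" if "x \<in> U i" "y \<in> U i" for x y i
  proof -
    have "dist x y \<le> dist (fst x) (fst y) + dist (snd x) (snd y)"
      by (rule dist_prod_le)
    also have "dist (fst x) (fst y) \<le> \<rho>"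
      using that by (auto simp: U_def dist_real_def)
    also have "dist (snd x) (snd y) \<le> \<rho>"
      using that by (auto simp: U_def dist_real_def)
    finally show ?thesis by simp
  qed
  have bU: "bounded (U i)" for i unfolding bounded_two_points using dU by blast
  have diU: "diameter (U i) \<le> 2 * \<rho>" for i
    using dU h(1) by (intro diameter_leI) auto
  have "K \<times> {-b..b} \<subseteq> (\<Union>i<N*L. U i)"
  proof
    fix z assume "z \<in> K \<times> {-b..b}"
    then obtain x y where z: "z = (x, y)" "x \<in> K" "-b \<le> y" "y \<le> b" by auto
    then obtain i where i: "i < N" "p i \<le> x" "x \<le> p i + \<rho>" using h(3) by auto
    define j where "j = nat \<lfloor>(y + b) / \<rho>\<rfloor>"
    have nn: "(y + b) / \<rho> \<ge> 0" using z h(1) by simp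
    have jr: "real j = of_int \<lfloor>(y + b) / \<rho>\<rfloor>" using nn by (simp add: j_def)
    have "(y + b) / \<rho> \<le> 2 * b / \<rho>" using z h(1) by (simp add: divide_right_mono)
    then have jL: "j < L" unfolding j_def L_def by (simp add: floor_mono nat_mono le_imp_less_Suc)
    have "real j \<le> (y + b) / \<rho>" "(y + b) / \<rho> \<le> real j + 1" unfolding jr by linarith+
    then have "real j * \<rho> \<le> y + b" "y + b \<le> real j * \<rho> + \<rho>"
      using h(1) by (simp_all add: field_simps)
    then have "z \<in> U (i * L + j)"
      using i z jL by (simp add: U_def)
    moreover have "i * L + j < N * L"
    proof -
      have "i * L + j < Suc i * L" using jL by simp
      also have "\<dots> \<le> N * L" using i by (intro mult_right_mono) auto
      finally show ?thesis .
    qed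
    ultimately show "z \<in> (\<Union>i<N*L. U i)" by blast
  qed
  moreover have "(\<Sum>i<N*L. diameter (U i) powr t) < e"
  proof -
    have "(\<Sum>i<N*L. diameter (U i) powr t) \<le> (\<Sum>i<N*L. (2 * \<rho>) powr t)"
      using diU diameter_ge_0[OF bU] assms(2) by (intro sum_mono powr_mono2) auto
    also have "\<dots> = real N * real L * (2 * \<rho>) powr t" by simp
    also have "\<dots> \<le> real N * (2 * b / \<rho> + 1) * (2 * \<rho>) powr t"
      using L by (intro mult_right_mono mult_left_mono) auto
    finally show ?thesis using h(4) by simp
  qed
  ultimately show "\<exists>(N::nat) U. (\<forall>i<N. bounded (U i) \<and> diameter (U i) \<le> d) \<and>
      K \<times> {-b..b} \<subseteq> (\<Union>i<N. U i) \<and> (\<Sum>i<N. diameter (U i) powr t) < e"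
    using bU diU h(2) by (intro exI[of _ "N*L"] exI[of _ U]) (auto intro: order_trans)
qed

text \<open>The extra interval is there for \<open>x = 1\<close>, whose index is
  \<open>n\<close>.\<close>

lemma unit_interval_subset_UN:
  assumes "n > (0::nat)"
  shows "{0..1::real} \<subseteq> (\<Union>i<Suc n. {real i / n..real i / n + 1 / n})"
proof
  fix x :: real assume x: "x \<in> {0..1}"
  define i where "i = nat \<lfloor>x * n\<rfloor>"
  have "real i = of_int \<lfloor>x * n\<rfloor>" using x by (simp add: i_def)
  then have "real i \<le> x * n" "x * n \<le> real i + 1" by linarith+
  then have "x \<in> {real i / n..real i / n + 1 / n}" using assms by (simp add: field_simps)
  moreover have "x * n \<le> n" using x by (simp add: mult_left_le_one_le)
  with \<open>real i \<le> x * n\<close> have "i < Suc n" by simp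
  ultimately show "x \<in> (\<Union>i<Suc n. {real i / n..real i / n + 1 / n})" by blast
qed

lemma hnull_unit_interval:
  assumes "1 < t"
  shows "hnull t {0..1::real}"
proof (rule hnull_finite_cover)
  fix d e :: real assume de: "d > 0" "e > 0"
  have "(\<lambda>n. real (Suc n) * (1 / real n) powr t) \<longlonglongrightarrow> 0" using assms by real_asymp
  then have "\<forall>\<^sub>F n in sequentially. real (Suc n) * (1 / real n) powr t < e"
    using de by (simp add: order_tendsto_iff)
  moreover have "(\<lambda>n. 1 / real n) \<longlonglongrightarrow> 0" by real_asymp
  then have "\<forall>\<^sub>F n in sequentially. 1 / real n < d"
    using de by (simp add: order_tendsto_iff)
  ultimately have "\<forall>\<^sub>F n in sequentially. real (Suc n) * (1 / real n) powr t < e \<and> 1 / real n < d \<and> n > 0"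
    using eventually_gt_at_top by eventually_elim auto
  then obtain n where n: "real (Suc n) * (1 / real n) powr t < e" "1 / real n < d" "n > 0"
    by (auto simp: eventually_sequentially)
  show "\<exists>(N::nat) U. (\<forall>i<N. bounded (U i) \<and> diameter (U i) \<le> d) \<and>
      {0..1::real} \<subseteq> (\<Union>i<N. U i) \<and> (\<Sum>i<N. diameter (U i) powr t) < e"
  proof (intro exI[of _ "Suc n"] exI[of _ "\<lambda>i. {real i / n..real i / n + 1 / n}"] conjI allI impI)
    show "{0..1} \<subseteq> (\<Union>i<Suc n. {real i / n..real i / n + 1 / n})"
      by (rule unit_interval_subset_UN[OF n(3)])
    show "(\<Sum>i<Suc n. diameter {real i / n..real i / n + 1 / n} powr t) < e"
      using n(1) by (simp add: diameter_closed_interval)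
    show "diameter {real i / n..real i / n + 1 / n} \<le> d" for i
      using n(2) by (simp add: diameter_closed_interval)
  qed auto
qed

lemma hnull_unit_interval_strip:
  assumes "2 < t" "0 \<le> b"
  shows "hnull t ({0..1::real} \<times> {-b..b::real})"
proof (rule hnull_strip)
  fix d e :: real assume de: "d > 0" "e > 0"
  have "(\<lambda>n. real (Suc n) * (2 * b * real n + 1) * (2 / real n) powr t) \<longlonglongrightarrow> 0"
  proof (cases "b = 0")
    case True
    have "(\<lambda>n. real (Suc n) * (2 / real n) powr t) \<longlonglongrightarrow> 0" using assms(1) by real_asymp
    then show ?thesis using True by simp
  next
    case False
    then have "b > 0" using assms by simp
    then show ?thesis using assms(1) by real_asymp
  qed
  then have "\<forall>\<^sub>F n in sequentially. real (Suc n) * (2 * b * real n + 1) * (2 / real n) powr t < e"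
    using de by (simp add: order_tendsto_iff)
  moreover have "(\<lambda>n. 2 / real n) \<longlonglongrightarrow> 0" by real_asymp
  then have "\<forall>\<^sub>F n in sequentially. 2 / real n < d"
    using de by (simp add: order_tendsto_iff)
  ultimately have "\<forall>\<^sub>F n in sequentially. real (Suc n) * (2 * b * real n + 1) * (2 / real n) powr t < e \<and> 2 / real n < d \<and> n > 0"
    using eventually_gt_at_top by eventually_elim auto
  then obtain n where n: "real (Suc n) * (2 * b * real n + 1) * (2 / real n) powr t < e" "2 / real n < d" "n > 0"
    by (auto simp: eventually_sequentially)
  show "\<exists>(N::nat) \<rho> p. 0 < \<rho> \<and> 2 * \<rho> \<le> d \<and> {0..1} \<subseteq> (\<Union>i<N. {p i..p i + \<rho>})
        \<and> real N * (2 * b / \<rho> + 1) * (2 * \<rho>) powr t < e"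
  proof (intro exI[of _ "Suc n"] exI[of _ "1 / n"] exI[of _ "\<lambda>i. real i / n"] conjI)
    show "{0..1} \<subseteq> (\<Union>i<Suc n. {real i / n..real i / n + 1 / n})"
      by (rule unit_interval_subset_UN[OF n(3)])
    show "real (Suc n) * (2 * b / (1 / real n) + 1) * (2 * (1 / real n)) powr t < e"
      using n(1) by simp
  qed (use n(2,3) in simp_all)
qed (use assms in auto)

lemma C01_bounded:
  assumes "f \<in> C01"
  obtains b where "b > 0" "\<And>x. \<bar>f x\<bar> \<le> b"
proof -
  have "bounded (f ` {0..1})"
    using assms by (auto simp: C01_def intro!: compact_imp_bounded compact_continuous_image)
  then obtain b where "b > 0" "\<forall>y\<in>f ` {0..1}. \<bar>y\<bar> \<le> b"
    by (auto simp: bounded_pos)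
  then have "\<bar>f x\<bar> \<le> b" for x
    using assms by (cases "x \<in> {0..1}") (auto simp: C01_def)
  with \<open>b > 0\<close> show ?thesis using that by blast
qed

text \<open>An infimum of reals yields a null exponent below \<open>t\<close> only if some null
  exponent exists; 3 is one, as a bounded strip over the unit interval is null above 2.\<close>

lemma hausdorff_dim_graph_less_imp_hnull:
  assumes "f \<in> C01" "hausdorff_dim (graph01 f) < t"
  shows "hnull t (graph01 f)"
proof -
  obtain b where b: "b > 0" "\<And>x. \<bar>f x\<bar> \<le> b" using C01_bounded[OF assms(1)] by blast
  have "graph01 f \<subseteq> {0..1} \<times> {-b..b}"
    using b(2) by (auto simp: graph01_def abs_le_iff minus_le_iff)
  then have "hnull 3 (graph01 f)"
    using hnull_unit_interval_strip[of 3 b] b(1) by (auto intro: hnull_subset)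
  then have "{t. 0 \<le> t \<and> hnull t (graph01 f)} \<noteq> {}" by (auto intro: exI[of _ 3])
  from cInf_lessD[OF this assms(2)[unfolded hausdorff_dim_altdef]]
  obtain t' where "t' < t" "hnull t' (graph01 f)" by blast
  then show ?thesis by (auto intro: hnull_mono)
qed

lemma hausdorff_dim_eqI:
  assumes "0 \<le> s" "\<And>t. s < t \<Longrightarrow> hnull t E" "\<And>t. 0 \<le> t \<Longrightarrow> t < s \<Longrightarrow> \<not> hnull t E"
  shows "hausdorff_dim E = s"
  unfolding hausdorff_dim_altdef
proof (rule cInf_eq_non_empty)
  show "{t. 0 \<le> t \<and> hnull t E} \<noteq> {}" using assms(1) assms(2)[of "s + 1"] by (auto intro!: exI[of _ "s+1"])
  show "s \<le> t" if "t \<in> {t. 0 \<le> t \<and> hnull t E}" for t using that assms(3) by force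
  show "y \<le> s" if y: "\<And>t. t \<in> {t. 0 \<le> t \<and> hnull t E} \<Longrightarrow> y \<le> t" for y
  proof (rule field_le_epsilon)
    fix e :: real assume "e > 0"
    then show "y \<le> s + e" using y[of "s + e"] assms(1) assms(2)[of "s + e"] by auto
  qed
qed

section \<open>Adding a linear function to a graph\<close>

definition ident01 :: "real \<Rightarrow> real" where
  "ident01 x = (if x \<in> {0..1} then x else 0)"

lemma hnull_graph_line: 
  assumes "1 < t" shows "hnull t (graph01 (fscale c ident01))"
proof -
  have "graph01 (fscale c ident01) = (\<lambda>x. (x, c * x)) ` {0..1}"
    by (auto simp: graph01_def fscale_def ident01_def)
  moreover have "hnull t ((\<lambda>x. (x, c * x)) ` {0..1::real})"
  proof (rule hnull_lipschitz_image[OF hnull_unit_interval[OF assms], of "1 + \<bar>c\<bar>"])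
    fix x y :: real
    have "dist (x, c * x) (y, c * y) \<le> dist x y + dist (c * x) (c * y)"
      using dist_prod_le[of "(x, c * x)" "(y, c * y)"] by simp
    also have "dist (c * x) (c * y) = \<bar>c\<bar> * dist x y"
      by (simp add: dist_real_def flip: right_diff_distrib abs_mult)
    finally show "dist (x, c * x) (y, c * y) \<le> (1 + \<bar>c\<bar>) * dist x y" by (simp add: algebra_simps)
  qed (use assms in auto)
  ultimately show ?thesis by simp
qed

lemma hausdorff_dim_line: "hausdorff_dim (graph01 (fscale c ident01)) \<le> 1"
proof (rule field_le_epsilon)
  fix e :: real assume "e > 0"
  then show "hausdorff_dim (graph01 (fscale c ident01)) \<le> 1 + e"
    unfolding hausdorff_dim_altdef using hnull_graph_line[of "1 + e" c]
    by (intro cInf_lower) (auto intro!: bdd_belowI[of _ 0])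
qed

text \<open>The shear \<open>(x, y) \<mapsto> (x, y + c * x)\<close> is Lipschitz on the plane and
  carries one graph to the other.\<close>

lemma hnull_graph_add_line:
  assumes "hnull t (graph01 f)" "0 \<le> t"
  shows "hnull t (graph01 (f + fscale c ident01))"
proof -
  define h where "h = (\<lambda>z :: real \<times> real. (fst z, snd z + c * fst z))"
  have "graph01 (f + fscale c ident01) = h ` graph01 f"
    unfolding graph01_def image_image h_def
    by (intro image_cong) (simp_all add: fscale_def ident01_def)
  moreover have "hnull t (h ` graph01 f)"
  proof (rule hnull_lipschitz_image[OF assms(1)])
    fix p q :: "real \<times> real"
    have "dist (h p) (h q) \<le> dist (fst p) (fst q) + dist (snd p + c * fst p) (snd q + c * fst q)"
      using dist_prod_le[of "h p" "h q"] by (simp add: h_def)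
    moreover have "dist (snd p + c * fst p) (snd q + c * fst q) \<le> dist (snd p) (snd q) + \<bar>c\<bar> * dist (fst p) (fst q)"
      using abs_triangle_ineq[of "snd p - snd q" "c * (fst p - fst q)"]
      by (simp add: dist_real_def abs_mult[symmetric] algebra_simps)
    moreover have "dist (fst p) (fst q) \<le> dist p q" "dist (snd p) (snd q) \<le> dist p q"
      by (rule dist_fst_le dist_snd_le)+
    moreover from this have "\<bar>c\<bar> * dist (fst p) (fst q) \<le> \<bar>c\<bar> * dist p q"
      by (intro mult_left_mono) auto
    ultimately have "dist (h p) (h q) \<le> dist p q + dist p q + \<bar>c\<bar> * dist p q" by linarith
    also have "\<dots> = (2 + \<bar>c\<bar>) * dist p q" by (simp add: distrib_right)
    finally show "dist (h p) (h q) \<le> (2 + \<bar>c\<bar>) * dist p q" .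
  qed (use assms in auto)
  ultimately show ?thesis by simp
qed

text \<open>Shearing back with \<open>-c\<close> gives the converse, so both graphs have the same
  null exponents.\<close>

lemma hausdorff_dim_graph_add_line:
  "hausdorff_dim (graph01 (f + fscale c ident01)) = hausdorff_dim (graph01 f)"
proof -
  have *: "f + fscale c ident01 + fscale (-c) ident01 = f"
    by (simp add: fscale_def fun_eq_iff)
  have "hnull t (graph01 (f + fscale c ident01)) \<longleftrightarrow> hnull t (graph01 f)" if "0 \<le> t" for t
    using hnull_graph_add_line[OF _ that, of f c]
      hnull_graph_add_line[OF _ that, of "f + fscale c ident01" "-c", unfolded *] by blast
  then show ?thesis unfolding hausdorff_dim_altdef by (metis (no_types, lifting))
qed

subsection \<open>Subspaces of C[0,1]\<close>

interpretation fs: vector_space fscale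
  by unfold_locales (auto simp: fscale_def fun_eq_iff algebra_simps)

lemma fscale_apply [simp]: "fscale c f x = c * f x"
  by (simp add: fscale_def)

lemma ident01_C01: "ident01 \<in> C01"
proof -
  have "continuous_on {0..1} ident01"
    by (rule continuous_on_eq[OF continuous_on_id]) (auto simp: ident01_def)
  then show ?thesis by (simp add: C01_def ident01_def)
qed

lemma subspace_C01: "fs.subspace C01"
  by (rule fs.subspaceI)
     (auto simp: C01_def fscale_def plus_fun_def zero_fun_def intro!: continuous_intros)

lemma span_subset_C01: "S \<subseteq> C01 \<Longrightarrow> fs.span S \<subseteq> C01"
  by (rule fs.span_minimal[OF _ subspace_C01])

text \<open>If \<open>f\<close> lies at distance \<open>d > 0\<close> from the closed span of
  \<open>S\<close>, the coefficients of \<open>f\<close> along a convergent sequence are Cauchy,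
  being controlled by the sup norm divided by \<open>d\<close>. Subtracting the multiples of
  \<open>f\<close> leaves a convergent sequence in the closed span.\<close>

lemma closed_C01_span_insert:
  assumes closed: "closed_C01 (fs.span S)" and S: "S \<subseteq> C01" and f: "f \<in> C01"
  shows "closed_C01 (fs.span (insert f S))"
proof (cases "f \<in> fs.span S")
  case True
  then show ?thesis using closed by (simp add: fs.span_redundant)
next
  case False
  have "\<exists>d>0. \<forall>z\<in>fs.span S. \<exists>x\<in>{0..1}. \<bar>f x - z x\<bar> \<ge> d"
  proof (rule ccontr)
    assume *: "\<not> ?thesis"
    have "\<exists>z\<in>fs.span S. \<forall>x\<in>{0..1}. \<bar>f x - z x\<bar> < 1 / real (Suc n)" for n
      using * by (force simp: not_le dest!: spec[of _ "1 / real (Suc n)"])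
    then obtain z where z: "\<And>n. z n \<in> fs.span S" "\<And>n x. x \<in> {0..1} \<Longrightarrow> \<bar>f x - z n x\<bar> < 1 / real (Suc n)"
      by metis
    have "uniform_limit {0..1} z f sequentially"
    proof (rule uniform_limitI)
      fix e :: real assume "e > 0"
      then obtain N where N: "1 / real (Suc N) < e" using nat_approx_posE by blast
      have "dist (z n x) (f x) < e" if "n \<ge> N" "x \<in> {0..1}" for n x
      proof -
        have "1 / real (Suc n) \<le> 1 / real (Suc N)" using that by (intro divide_left_mono) auto
        with z(2)[OF that(2), of n] N show ?thesis by (simp add: dist_real_def abs_minus_commute)
      qed
      then show "\<forall>\<^sub>F n in sequentially. \<forall>x\<in>{0..1}. dist (z n x) (f x) < e"
        unfolding eventually_sequentially by blast
    qed
    then have "f \<in> fs.span S" using closed z(1) f unfolding closed_C01_def by blast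
    with False show False by simp
  qed
  then obtain d where d: "d > 0" "\<And>z. z \<in> fs.span S \<Longrightarrow> \<exists>x\<in>{0..1}. \<bar>f x - z x\<bar> \<ge> d"
    by blast
  show ?thesis
    unfolding closed_C01_def
  proof (intro allI impI, elim conjE)
    fix g F assume g: "\<forall>n. g n \<in> fs.span (insert f S)" and F: "F \<in> C01"
      and lim: "uniform_limit {0..1} g F sequentially"
    from g obtain c where c: "\<And>n. g n - fscale (c n) f \<in> fs.span S"
      unfolding fs.span_breakdown_eq by metis
    have bound: "\<exists>x\<in>{0..1}. \<bar>c n - c m\<bar> * d \<le> \<bar>g n x - g m x\<bar>" for n m
    proof (cases "c n = c m")
      case False
      \<comment> \<open>Chosen so that \<open>f - z\<close> is
        \<open>(g n - g m) / (c n - c m)\<close>, to which the distance bound applies.\<close>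
      define z where "z = fscale (- 1 / (c n - c m)) ((g n - fscale (c n) f) - (g m - fscale (c m) f))"
      have "z \<in> fs.span S" unfolding z_def by (intro fs.span_scale fs.span_diff c)
      from d(2)[OF this] obtain x where x: "x \<in> {0..1}" "d \<le> \<bar>f x - z x\<bar>" by blast
      have "(c n - c m) * (f x - z x) = g n x - g m x"
      proof -
        have "(c n - c m) * z x = - ((g n x - c n * f x) - (g m x - c m * f x))"
          using False by (simp add: z_def)
        then show ?thesis by (simp add: algebra_simps)
      qed
      then have "\<bar>c n - c m\<bar> * \<bar>f x - z x\<bar> = \<bar>g n x - g m x\<bar>" by (metis abs_mult)
      with x show ?thesis by (metis abs_ge_zero mult_left_mono)
    qed (auto intro!: bexI[of _ 0])
    have "Cauchy c"
    proof (rule CauchyI)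
      fix e :: real assume "e > 0"
      with d have "e * d / 2 > 0" by simp
      from uniform_limitD[OF lim this] obtain N where
        N: "\<And>n x. n \<ge> N \<Longrightarrow> x \<in> {0..1} \<Longrightarrow> dist (g n x) (F x) < e * d / 2"
        unfolding eventually_sequentially by blast
      show "\<exists>M. \<forall>m\<ge>M. \<forall>n\<ge>M. norm (c m - c n) < e"
      proof (intro exI[of _ N] allI impI)
        fix m n assume mn: "m \<ge> N" "n \<ge> N"
        obtain x where x: "x \<in> {0..1}" "\<bar>c m - c n\<bar> * d \<le> \<bar>g m x - g n x\<bar>" using bound by blast
        have "\<bar>g m x - g n x\<bar> < e * d"
          using dist_triangle_half_l[OF N[OF mn(1) x(1)] N[OF mn(2) x(1)]] by (simp add: dist_real_def)
        with x(2) have "\<bar>c m - c n\<bar> * d < e * d" by simp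
        then show "norm (c m - c n) < e" using d(1) by simp
      qed
    qed
    then obtain k where k: "c \<longlonglongrightarrow> k" using Cauchy_convergent_iff convergent_def by blast
    obtain b where b: "b > 0" "\<And>x. \<bar>f x\<bar> \<le> b" using C01_bounded[OF f] by blast
    have "uniform_limit {0..1} (\<lambda>n. g n - fscale (c n) f) (F - fscale k f) sequentially"
    proof (rule uniform_limitI)
      fix e :: real assume "e > 0"
      then have "e / (2 * b) > 0" using b by simp
      from LIMSEQ_D[OF k this] have "\<forall>\<^sub>F n in sequentially. \<bar>c n - k\<bar> < e / (2 * b)"
        by (auto simp: eventually_sequentially)
      moreover from \<open>e > 0\<close> have "\<forall>\<^sub>F n in sequentially. \<forall>x\<in>{0..1}. dist (g n x) (F x) < e / 2"
        by (intro uniform_limitD[OF lim]) simp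
      ultimately show "\<forall>\<^sub>F n in sequentially. \<forall>x\<in>{0..1}.
          dist ((g n - fscale (c n) f) x) ((F - fscale k f) x) < e"
      proof eventually_elim
        case (elim n)
        show ?case
        proof
          fix x :: real assume x: "x \<in> {0..1}"
          have "\<bar>(c n - k) * f x\<bar> \<le> \<bar>c n - k\<bar> * b" using b by (simp add: abs_mult mult_left_mono)
          also have "\<dots> < e / 2" using elim(1) b by (simp add: field_simps)
          finally have "\<bar>(c n - k) * f x\<bar> < e / 2" .
          moreover have "\<bar>g n x - F x\<bar> < e / 2" using elim(2) x by (simp add: dist_real_def)
          moreover have "(g n - fscale (c n) f) x - (F - fscale k f) x = (g n x - F x) - (c n - k) * f x"
            by (simp add: algebra_simps)
          ultimately show "dist ((g n - fscale (c n) f) x) ((F - fscale k f) x) < e"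
            unfolding dist_real_def by linarith
        qed
      qed
    qed
    moreover have "F - fscale k f \<in> C01"
      using fs.subspace_diff[OF subspace_C01 F fs.subspace_scale[OF subspace_C01 f]] .
    ultimately have "F - fscale k f \<in> fs.span S"
      using closed[unfolded closed_C01_def, rule_format, of "\<lambda>n. g n - fscale (c n) f"] c by auto
    then show "F \<in> fs.span (insert f S)" unfolding fs.span_breakdown_eq by blast
  qed
qed

lemma closed_C01_span_Un:
  assumes "finite B" "B \<subseteq> C01" "S \<subseteq> C01" "closed_C01 (fs.span S)"
  shows "closed_C01 (fs.span (B \<union> S))"
  using assms by (induction B rule: finite_induct) (auto intro!: closed_C01_span_insert)

section \<open>Cardinality of C[0,1] and of its subspaces\<close>

text \<open>Real numbers are coded by sets of naturals, so a function on the rationals becomes a set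
  of pairs, again coded by a set of naturals.\<close>

lemma rat_functions_lepoll_reals: "(UNIV :: (rat \<Rightarrow> real) set) \<lesssim> (UNIV :: real set)"
proof -
  obtain r :: "real \<Rightarrow> nat set" where r: "inj r"
    using eqpoll_imp_lepoll[OF eqpoll_sym[OF nat_sets_eqpoll_reals]] by (auto simp: lepoll_def)
  define h :: "(rat \<Rightarrow> real) \<Rightarrow> nat set" where
    "h f = {prod_encode (to_nat q, k) | q k. k \<in> r (f q)}" for f
  have "inj h"
  proof (rule injI)
    fix f g assume eq: "h f = h g"
    have "r (f q) = r (g q)" for q
    proof -
      have "k \<in> r (f q) \<longleftrightarrow> prod_encode (to_nat q, k) \<in> h f" for k and f :: "rat \<Rightarrow> real"
        by (auto simp: h_def)
      then show ?thesis using eq by blast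
    qed
    then show "f = g" using r by (auto simp: inj_def)
  qed
  then have "(UNIV :: (rat \<Rightarrow> real) set) \<lesssim> (UNIV :: nat set set)" by (auto simp: lepoll_def)
  then show ?thesis using nat_sets_eqpoll_reals lepoll_trans1 eqpoll_imp_lepoll lepoll_trans by blast
qed

text \<open>A continuous function is determined by its values at rational points.\<close>

lemma C01_lepoll_reals: "C01 \<lesssim> (UNIV :: real set)"
proof -
  have "inj_on (\<lambda>f (q::rat). f (of_rat q :: real) :: real) C01"
  proof (rule inj_onI, rule ext)
    fix f g :: "real \<Rightarrow> real" and x :: real
    assume fg: "f \<in> C01" "g \<in> C01" and eq: "(\<lambda>q::rat. f (of_rat q)) = (\<lambda>q. g (of_rat q))"
    show "f x = g x"
    proof (cases "x \<in> {0..1}")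
      case True
      show ?thesis
      proof (rule ccontr)
        assume "f x \<noteq> g x"
        have "continuous_on {0..1} (\<lambda>x. f x - g x)"
          using fg by (auto simp: C01_def intro!: continuous_intros)
        moreover have "\<bar>f x - g x\<bar> > 0" using \<open>f x \<noteq> g x\<close> by simp
        ultimately obtain d where d: "d > 0"
          "\<And>y. y \<in> {0..1} \<Longrightarrow> dist y x < d \<Longrightarrow> dist (f y - g y) (f x - g x) < \<bar>f x - g x\<bar>"
          using True unfolding continuous_on_iff by metis
        \<comment> \<open>The cut-off keeps the rational inside the unit interval even when
          \<open>x\<close> is an endpoint.\<close>
        have "max 0 (x - d) < min 1 (x + d)" using True d(1) by auto
        from of_rat_dense[OF this] obtain q where q: "max 0 (x - d) < of_rat q" "of_rat q < min 1 (x + d)"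
          by blast
        then have "dist (f (of_rat q) - g (of_rat q)) (f x - g x) < \<bar>f x - g x\<bar>"
          by (intro d(2)) (auto simp: dist_real_def)
        moreover have "f (of_rat q) = g (of_rat q)" using fun_cong[OF eq, of q] by simp
        ultimately show False by (simp add: dist_real_def)
      qed
    qed (use fg in \<open>auto simp: C01_def\<close>)
  qed
  then have "C01 \<lesssim> (UNIV :: (rat \<Rightarrow> real) set)" by (auto simp: lepoll_def)
  then show ?thesis using rat_functions_lepoll_reals lepoll_trans by blast
qed

text \<open>The family gives continuum many independent elements, which extend to a basis; as
  \<open>C01\<close> itself has at most continuum many elements, the basis cannot be larger.\<close>

lemma has_dim_continuumI:
  fixes \<phi> :: "real \<Rightarrow> real \<Rightarrow> real"
  assumes V: "lin_subspace V" and \<phi>: "\<And>t. t \<in> {0<..<1} \<Longrightarrow> \<phi> t \<in> V"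
    and ind: "\<And>T c t. finite T \<Longrightarrow> T \<subseteq> {0<..<1} \<Longrightarrow> (\<Sum>t\<in>T. fscale (c t) (\<phi> t)) = 0 \<Longrightarrow> t \<in> T \<Longrightarrow> c t = 0"
  shows "has_dim V (UNIV :: real set)"
proof -
  \<comment> \<open>Two equal members would satisfy a linear relation with coefficients 1 and
    -1.\<close>
  have inj: "inj_on \<phi> {0<..<1}"
  proof (rule inj_onI, rule ccontr)
    fix t u assume tu: "t \<in> {0<..<1}" "u \<in> {0<..<1}" "\<phi> t = \<phi> u" "t \<noteq> u"
    have "(\<Sum>v\<in>{t, u}. fscale (if v = t then 1 else -1) (\<phi> v)) = 0"
      using tu(3,4) by (simp add: fun_eq_iff)
    from ind[OF _ _ this, of t] tu show False by auto
  qed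
  have indep: "fs.independent (\<phi> ` {0<..<1})"
    unfolding fs.independent_explicit_finite_subsets
  proof (intro allI impI ballI)
    fix S u v assume S: "S \<subseteq> \<phi> ` {0<..<1}" "finite S" "(\<Sum>v\<in>S. fscale (u v) v) = 0" "v \<in> S"
    then obtain T where T: "T \<subseteq> {0<..<1}" "finite T" "S = \<phi> ` T"
      using finite_subset_image[OF S(2,1)] by blast
    have "inj_on \<phi> T" using inj T(1) inj_on_subset by blast
    then have "(\<Sum>t\<in>T. fscale (u (\<phi> t)) (\<phi> t)) = 0" using S(3) T(3) by (simp add: sum.reindex)
    from ind[OF T(2,1) this] S(4) T(3) show "u v = 0" by auto
  qed
  have "\<phi> ` {0<..<1} \<subseteq> V" using \<phi> by auto
  from fs.maximal_independent_subset_extend[OF this indep]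
  obtain B where B: "\<phi> ` {0<..<1} \<subseteq> B" "B \<subseteq> V" "fs.independent B" "V \<subseteq> fs.span B" by blast
  have "fs.span B = V"
    using B V by (intro antisym fs.span_minimal) (auto simp: lin_subspace_def)
  moreover have "B \<approx> (UNIV :: real set)"
  proof (rule lepoll_antisym)
    have "B \<subseteq> C01" using B(2) V by (auto simp: lin_subspace_def)
    then show "B \<lesssim> (UNIV :: real set)" using C01_lepoll_reals subset_imp_lepoll lepoll_trans by blast
    have "(UNIV :: real set) \<lesssim> {0<..<1::real}"
      by (rule eqpoll_imp_lepoll[OF eqpoll_sym[OF open_interval_eqpoll_reals[THEN iffD2]]]) simp
    also have "{0<..<1::real} \<lesssim> B" using inj B(1) unfolding lepoll_def by blast
    finally show "(UNIV :: real set) \<lesssim> B" .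
  qed
  ultimately show ?thesis unfolding has_dim_def using B by blast
qed

section \<open>Infinite-dimensional subspaces\<close>

lemma ident01_nonzero: "ident01 \<noteq> 0"
  by (auto simp: fun_eq_iff ident01_def intro!: exI[of _ 1])

lemma line_notin_H_s:
  assumes "1 < s" "f = fscale c ident01" shows "f \<notin> H_s s"
  using hausdorff_dim_line[of c] assms by (auto simp: H_s_def)

lemma not_spaceable_infinite_dim:
  fixes A :: "'a set" and B :: "'b set"
  assumes "1 < s" "infinite A"
  shows "\<not> spaceable (H_s s) A B"
proof
  assume sp: "spaceable (H_s s) A B"
  then obtain M B0 where M: "lin_subspace M" "M \<subseteq> H_s s \<union> {0}"
    and B0: "B0 \<subseteq> M" "fs.independent B0" "fs.span B0 = M" "B0 \<approx> A"
    unfolding spaceable_def lineable_def has_dim_def by auto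
  have MC: "M \<subseteq> C01" using M by (simp add: lin_subspace_def)
  have "infinite B0" using B0(4) assms(2) eqpoll_finite_iff by blast
  then obtain b :: "nat \<Rightarrow> real \<Rightarrow> real" where b: "inj b" "range b \<subseteq> B0"
    using infinite_countable_subset by blast
  have bC: "b n \<in> C01" for n using b(2) B0(1) MC by blast
  have "\<exists>k>0. \<forall>x. \<bar>b n x\<bar> \<le> k" for n using C01_bounded[OF bC] by metis
  then obtain K where K: "\<And>n. K n > 0" "\<And>n x. \<bar>b n x\<bar> \<le> K n" by metis
  interpret vp: vector_space_pair fscale "(*) :: real \<Rightarrow> real \<Rightarrow> real" by unfold_locales
      (auto simp: algebra_simps)
  \<comment> \<open>\<open>K n\<close> bounds the sup norm of \<open>b n\<close>, so
    \<open>b n / l (b n)\<close> is at most \<open>1 / (n+1)\<close> in absolute value and tends to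
    0 uniformly.\<close>
  obtain l where l: "Vector_Spaces.linear fscale (*) l"
     "\<And>v. v \<in> B0 \<Longrightarrow> l v = (if v \<in> range b then real (Suc (inv b v)) * K (inv b v) else 0)"
    using vp.linear_independent_extend[OF B0(2), of "\<lambda>v. if v \<in> range b then real (Suc (inv b v)) * K (inv b v) else 0"]
    by blast
  interpret l: Vector_Spaces.linear fscale "(*)" l by (rule l(1))
  have lb: "l (b n) = real (Suc n) * K n" for n
    using l(2)[of "b n"] b by auto
  define \<Psi> where "\<Psi> g = g + fscale (l g) ident01" for g
  interpret \<Psi>: Vector_Spaces.linear fscale fscale \<Psi>
    by unfold_locales (auto simp: \<Psi>_def l.add l.scale fun_eq_iff algebra_simps)
  define W where "W = \<Psi> ` M"
  have W_span: "W = fs.span (\<Psi> ` B0)" using \<Psi>.span_image B0(3) by (simp add: W_def)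
  \<comment> \<open>A kernel element is a multiple of \<open>ident01\<close>, whose graph has
    dimension at most 1, so it cannot lie in \<open>H_s s\<close>.\<close>
  have inj: "inj_on \<Psi> M"
  proof (subst \<Psi>.inj_on_iff_eq_0)
    show "fs.subspace M" using M by (simp add: lin_subspace_def)
    show "\<forall>g\<in>M. \<Psi> g = 0 \<longrightarrow> g = 0"
    proof (intro ballI impI)
      fix g assume g: "g \<in> M" "\<Psi> g = 0"
      then have "g = fscale (- l g) ident01"
        by (auto simp: \<Psi>_def fun_eq_iff algebra_simps eq_neg_iff_add_eq_0)
      then have "g \<notin> H_s s" using line_notin_H_s assms(1) by blast
      then show "g = 0" using g(1) M(2) by auto
    qed
  qed
  have "lin_subspace W"
  proof -
    have "W \<subseteq> C01"
      unfolding W_def \<Psi>_def using MC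
      by (auto intro!: fs.subspace_add[OF subspace_C01] fs.subspace_scale[OF subspace_C01] ident01_C01)
    then show ?thesis unfolding lin_subspace_def W_span using fs.subspace_span by simp
  qed
  moreover have "has_dim W A"
  proof -
    have "fs.independent (\<Psi> ` B0)"
      using inj B0 by (intro \<Psi>.independent_injective_image) auto
    moreover have "\<Psi> ` B0 \<approx> A"
      using inj B0(1,4) inj_on_image_eqpoll_self[of \<Psi> B0] inj_on_subset eqpoll_trans by blast
    moreover have "\<Psi> ` B0 \<subseteq> W" using B0(1) by (auto simp: W_def)
    ultimately show ?thesis unfolding has_dim_def using W_span by blast
  qed
  moreover have "W \<subseteq> H_s s \<union> {0}"
  proof
    fix h assume "h \<in> W"
    then obtain g where g: "g \<in> M" "h = \<Psi> g" by (auto simp: W_def)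
    show "h \<in> H_s s \<union> {0}"
    proof (cases "g = 0")
      case True
      then show ?thesis using g \<Psi>.zero by simp
    next
      case False
      then have "g \<in> H_s s" using g M(2) by blast
      moreover have "h \<in> C01" using \<open>h \<in> W\<close> \<open>lin_subspace W\<close> by (auto simp: lin_subspace_def)
      ultimately show ?thesis using g(2) by (auto simp: H_s_def \<Psi>_def hausdorff_dim_graph_add_line)
    qed
  qed
  ultimately have "lin_subspace W \<and> has_dim W A \<and> W \<subseteq> H_s s \<union> {0}" by simp
  from sp[unfolded spaceable_def, THEN conjunct2, THEN spec, THEN mp, OF this]
  obtain V where V: "lin_subspace V" "closed_C01 V" "W \<subseteq> V" "V \<subseteq> H_s s \<union> {0}"
    by (elim exE conjE)
  have "ident01 \<in> V"
  proof -
    \<comment> \<open>Normalised so that \<open>ident01\<close> has coefficient 1 while the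
      remainder \<open>b n / l (b n)\<close> tends to 0.\<close>
    define g where "g n = fscale (1 / l (b n)) (\<Psi> (b n))" for n
    have "g n \<in> V" for n
    proof -
      have "\<Psi> (b n) \<in> V" using b(2) B0(1) V(3) by (auto simp: W_def)
      then show ?thesis using V(1) fs.subspace_scale by (simp add: g_def lin_subspace_def)
    qed
    moreover have "uniform_limit {0..1} g ident01 sequentially"
    proof (rule uniform_limitI)
      fix e :: real assume "e > 0"
      then obtain N where N: "1 / real (Suc N) < e" using nat_approx_posE by blast
      have "dist (g n x) (ident01 x) < e" if "n \<ge> N" for n x
      proof -
        have "l (b n) > 0" using K(1)[of n] by (simp add: lb)
        then have "g n x - ident01 x = b n x / l (b n)"
          by (simp add: g_def \<Psi>_def field_simps)
        then have "dist (g n x) (ident01 x) = \<bar>b n x\<bar> / (real (Suc n) * K n)"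
          using K(1)[of n] by (simp add: dist_real_def lb abs_mult)
        also have "\<dots> \<le> K n / (real (Suc n) * K n)"
          using K by (intro divide_right_mono) (auto simp: less_imp_le)
        also have "\<dots> = 1 / real (Suc n)" using K(1)[of n] by simp
        also have "\<dots> \<le> 1 / real (Suc N)" using that by (intro divide_left_mono) auto
        finally show ?thesis using N by simp
      qed
      then show "\<forall>\<^sub>F n in sequentially. \<forall>x\<in>{0..1}. dist (g n x) (ident01 x) < e"
        unfolding eventually_sequentially by blast
    qed
    ultimately show ?thesis using V(2) ident01_C01 unfolding closed_C01_def by blast
  qed
  then have "ident01 \<in> H_s s" using V(4) ident01_nonzero by blast
  then show False using line_notin_H_s[OF assms(1), of ident01 1] by simp
qed

subsection \<open>The Cantor function\<close>

text \<open>\<open>M n\<close> counts the cells of level \<open>n\<close> in the parameter interval,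
  and divisibility nests the levels. The cubic exponent outgrows the square in \<open>amp\<close>
  even after multiplication by the level, see \<open>rho_le_amp\<close> and
  \<open>coarse_sum_le\<close>. Growth is bounded only from below, which leaves room to beat any
  given modulus of continuity.\<close>

locale cantor_scale =
  fixes s :: real and M :: "nat \<Rightarrow> nat"
  assumes s: "1 < s" "s \<le> 2"
    and M_pos: "M n > 0" 
    and M_dvd: "M n dvd M (Suc n)"
    and M_growth: "2 ^ ((n + 3) ^ 3) * M n \<le> M (Suc n)"
begin

text \<open>The ratios \<open>amp n / amp (n + 1)\<close> grow more slowly than any power of \<open>1 / amp n\<close>, and \<open>1 / amp (n + 1)\<close>
  more slowly than any power of \<open>1 / rho n\<close>; so both may be lost in the lower bound. The scale \<open>rho n\<close>
  satisfies \<open>M n * rho n powr (s - 1) = 1\<close>, and the extra factor in \<open>gap\<close> makes the gaps summable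
  even when \<open>s = 2\<close>.\<close>

definition amp :: "nat \<Rightarrow> real" where "amp n = (1/2) ^ (n ^ 2)"

definition rho :: "nat \<Rightarrow> real" where "rho n = real (M n) powr (- 1 / (s - 1))"

definition gap :: "nat \<Rightarrow> real" where "gap n = (1/2) ^ Suc n * (rho n * M n)"

lemma M_simps [simp]: "0 < M n" "M n \<noteq> 0" "Suc 0 \<le> M n"
  using M_pos[of n] by auto

lemma M_ge1 [simp]: "real (M n) \<ge> 1"
  using M_pos[of n] by linarith

lemma M_real_pos [simp]: "real (M n) > 0"
  using M_pos[of n] by simp

lemma M_dvd_le: "m \<le> n \<Longrightarrow> M m dvd M n"
  by (induction rule: dec_induct) (auto intro: dvd_trans M_dvd)

lemma M_le: "m \<le> n \<Longrightarrow> M m \<le> M n"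
  using M_dvd_le M_pos by (auto intro: dvd_imp_le)

lemma M_Suc_ge: "2 ^ ((n + 3) ^ 3) \<le> M (Suc n)"
proof -
  have "2 ^ ((n + 3) ^ 3) * 1 \<le> 2 ^ ((n + 3) ^ 3) * M n"
    using M_pos[of n] by (intro mult_left_mono) auto
  then show ?thesis using M_growth[of n] by (simp only: mult_1_right)
qed

lemma M_Suc_gt: "2 * M n < M (Suc n)"
proof -
  have "2 ^ 2 \<le> (2::nat) ^ ((n + 3) ^ 3)"
  proof (rule power_increasing)
    have "2 \<le> (n + 3) ^ 1" by simp
    also have "\<dots> \<le> (n + 3) ^ 3" by (rule power_increasing) auto
    finally show "2 \<le> (n + 3) ^ 3" .
  qed simp
  then have "4 * M n \<le> 2 ^ ((n + 3) ^ 3) * M n" by (intro mult_right_mono) auto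
  also note M_growth[of n]
  finally have "4 * M n \<le> M (Suc n)" .
  moreover have "0 < M n" by simp
  ultimately show ?thesis by linarith
qed

lemma M_ge_exp: "2 ^ n \<le> M n"
proof (induction n)
  case 0
  then show ?case using M_pos[of 0] by simp
next
  case (Suc n)
  then show ?case using M_Suc_gt[of n] by simp
qed

lemma M_tendsto: "filterlim (\<lambda>n. real (M n)) at_top sequentially"
proof (rule filterlim_at_top_mono)
  show "filterlim (\<lambda>n. (2::real) ^ n) at_top sequentially" by real_asymp
  show "\<forall>\<^sub>F n in sequentially. (2::real) ^ n \<le> real (M n)"
    using M_ge_exp by (intro always_eventually) (metis of_nat_le_iff of_nat_numeral of_nat_power)
qed

lemma amp_pos [simp]: "amp n > 0"
  by (simp add: amp_def)

lemma amp_le1: "amp n \<le> 1"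
  by (simp add: amp_def power_le_one)

lemma amp_Suc: "amp n = 2 ^ (2 * n + 1) * amp (Suc n)"
proof -
  have "(Suc n)\<^sup>2 = n\<^sup>2 + (2 * n + 1)" by (simp add: power2_eq_square)
  then show ?thesis by (simp add: amp_def power_add power_one_over field_simps)
qed

lemma amp_antimono: "m \<le> n \<Longrightarrow> amp n \<le> amp m"
  unfolding amp_def by (intro power_decreasing power_mono) auto

lemma amp_add_le: "amp (n + i) \<le> amp n * (1/2) ^ i"
proof -
  have "n\<^sup>2 + i \<le> n\<^sup>2 + i\<^sup>2" by (cases i) (auto simp: power2_eq_square)
  also have "\<dots> \<le> (n + i)\<^sup>2" by (simp add: power2_eq_square algebra_simps)
  finally have "amp (n + i) \<le> (1/2) ^ (n\<^sup>2 + i)"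
    unfolding amp_def by (intro power_decreasing) auto
  then show ?thesis by (simp add: amp_def power_add)
qed

lemma rho_pos [simp]: "rho n > 0"
  by (simp add: rho_def M_pos)

lemma rho_nonneg [simp]: "rho n \<ge> 0"
  by (simp add: less_imp_le)

lemma rho_less: "rho (Suc n) < rho n"
proof -
  have "real (M n) < real (M (Suc n))" using M_Suc_gt[of n] by simp
  then show ?thesis unfolding rho_def using s M_pos by (intro powr_less_mono2_neg) auto
qed

text \<open>\<open>s \<le> 2\<close> makes the exponent \<open>- 1 / (s - 1)\<close> at most
  -1.\<close>

lemma rho_le_inverse: "rho n \<le> 1 / M n"
proof -
  have "rho n \<le> real (M n) powr (-1)"
    unfolding rho_def using s by (intro powr_mono) (auto simp: field_simps Suc_le_eq M_pos)
  then show ?thesis by (simp add: powr_minus_divide)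
qed

lemma rho_tendsto: "rho \<longlonglongrightarrow> 0"
proof (rule tendsto_sandwich[where f = "\<lambda>_. 0" and h = "\<lambda>n. 1 / real (M n)"])
  show "(\<lambda>n. 1 / real (M n)) \<longlonglongrightarrow> 0"
    by (intro tendsto_divide_0[OF tendsto_const] filterlim_at_top_imp_at_infinity M_tendsto)
  show "\<forall>\<^sub>F n in sequentially. 0 \<le> rho n" by (simp add: less_imp_le)
  show "\<forall>\<^sub>F n in sequentially. rho n \<le> 1 / real (M n)" using rho_le_inverse by simp
qed simp

lemma rho_powr: "rho n powr (s - 1) = 1 / M n"
proof -
  have "- 1 / (s - 1) * (s - 1) = - 1" using s by simp
  then show ?thesis unfolding rho_def powr_powr by (simp only: powr_minus_divide powr_one_gt_zero_iff M_real_pos powr_one)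
qed

lemma rho_mult_M: "rho n * M n = rho n powr (2 - s)"
proof -
  have "rho n powr (2 - s) = rho n powr (1 - (s - 1))" by simp
  also have "\<dots> = rho n powr 1 / rho n powr (s - 1)" by (rule powr_diff)
  also have "\<dots> = rho n * M n" using rho_powr by (simp add: less_imp_le)
  finally show ?thesis by simp
qed

lemma rho_antimono: "m \<le> n \<Longrightarrow> rho n \<le> rho m"
  by (rule lift_Suc_antimono_le) (auto intro: less_imp_le rho_less)

lemma rho_mult_M_antimono: "m \<le> n \<Longrightarrow> rho n * M n \<le> rho m * M m"
  unfolding rho_mult_M using s rho_antimono by (intro powr_mono2) (auto intro: less_imp_le)

lemma rho_mult_M_le1: "rho n * M n \<le> 1"
  using rho_le_inverse[of n] by (simp add: pos_le_divide_eq)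

text \<open>Makes \<open>1 / amp (n+1)\<close> at most \<open>rho n powr (- 1 / (n+1))\<close>, a
  negligible loss. The right side is \<open>(1/2) ^ ((n+1)^3)\<close>, and the step from
  \<open>M (n-1)\<close> to \<open>M n\<close> supplies the exponent \<open>(n+2)^3\<close>; for
  \<open>n = 0\<close> there is no such step.\<close>

lemma rho_le_amp:
  assumes "n \<ge> 1" shows "rho n \<le> amp (Suc n) ^ Suc n"
proof -
  obtain m where n: "n = Suc m" using assms by (cases n) auto
  have "rho n \<le> 1 / M n" by (rule rho_le_inverse)
  also have "\<dots> \<le> 1 / 2 ^ ((m + 3) ^ 3)"
  proof (rule divide_left_mono)
    show "2 ^ ((m + 3) ^ 3) \<le> real (M n)"
      using M_Suc_ge[of m] n by (metis of_nat_le_iff of_nat_numeral of_nat_power)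
  qed auto
  also have "\<dots> = (1/2) ^ ((m + 3) ^ 3)" by (simp add: power_one_over)
  also have "\<dots> \<le> (1/2) ^ ((Suc n) ^ 2 * Suc n)"
  proof (rule power_decreasing)
    have "(Suc n) ^ 2 * Suc n = (m + 2) ^ 3" by (simp add: n power3_eq_cube power2_eq_square)
    also have "\<dots> \<le> (m + 3) ^ 3" by (rule power_mono) auto
    finally show "(Suc n) ^ 2 * Suc n \<le> (m + 3) ^ 3" .
  qed auto
  also have "\<dots> = amp (Suc n) ^ Suc n" by (simp only: amp_def power_mult)
  finally show ?thesis .
qed

lemma gap_pos [simp]: "gap n > 0"
  unfolding gap_def by (intro mult_pos_pos) auto

lemma gap_le: "k \<le> n \<Longrightarrow> gap n \<le> (1/2) ^ Suc n * (rho k * M k)"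
  unfolding gap_def using rho_mult_M_antimono by (intro mult_left_mono) auto

lemma gap_le': "gap n \<le> (1/2) ^ Suc n"
  unfolding gap_def using rho_mult_M_le1[of n] by (simp add: mult_left_le)

section \<open>Cells of the parameter interval\<close>

text \<open>Number of the half-open cell of level \<open>n\<close> that contains \<open>u\<close>.
  The point 1 gets the additional index \<open>M n\<close>, hence the \<open>Suc (M n)\<close>
  intervals in \<open>core_cover\<close>.\<close>

definition idx :: "nat \<Rightarrow> real \<Rightarrow> int" where
  "idx n u = \<lfloor>real (M n) * u\<rfloor>"

lemma idx_le: "real_of_int (idx n u) \<le> real (M n) * u" "real (M n) * u < real_of_int (idx n u) + 1"
  by (auto simp: idx_def)

lemma idx_mono: "u \<le> v \<Longrightarrow> idx n u \<le> idx n v"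
  unfolding idx_def by (intro floor_mono mult_left_mono) auto

lemma idx_bounds:
  assumes "u \<in> {0..1}" shows "0 \<le> idx n u" "idx n u \<le> M n"
proof -
  have "real (M n) * u \<le> real (M n)" using assms by (simp add: mult_left_le)
  then have "real_of_int (idx n u) \<le> real (M n)" using idx_le(1)[of n u] by linarith
  then show "idx n u \<le> M n" by linarith
  show "0 \<le> idx n u" using assms by (simp add: idx_def)
qed

text \<open>By divisibility a coarse index is the integer quotient of a finer one.\<close>

lemma idx_coarser:
  assumes "m \<le> n" "idx n u = idx n v" shows "idx m u = idx m v"
proof -
  obtain q where q: "M n = M m * q" using M_dvd_le[OF assms(1)] by (auto simp: dvd_def)
  have "q > 0" using q M_pos[of n] by (auto intro: Nat.gr0I)
  have "idx m x = idx n x div int q" for x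
  proof -
    have "real (M m) * x = (real (M n) * x) / real_of_int (int q)" using q \<open>q > 0\<close> by simp
    then show ?thesis unfolding idx_def
      using floor_divide_real_eq_div[of "int q" "real (M n) * x"] by simp
  qed
  with assms(2) show ?thesis by simp
qed

lemma idx_finer:
  assumes "k \<le> n" "idx k u = idx k v"
  shows "real_of_int (idx n v - idx n u) \<le> M n / M k"
proof -
  obtain q where q: "M n = M k * q" using M_dvd_le[OF assms(1)] by (auto simp: dvd_def)
  then have Mn: "real (M n) = real q * real (M k)" by simp
  have "real q * real_of_int (idx k u) \<le> real q * (real (M k) * u)"
    by (intro mult_left_mono idx_le) auto
  then have "real_of_int (int q * idx k u) \<le> real (M n) * u" by (simp add: Mn algebra_simps)
  then have "int q * idx k u \<le> idx n u" unfolding idx_def[of n] by (simp only: le_floor_iff)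
  then have 1: "real q * real_of_int (idx k u) \<le> real_of_int (idx n u)"
    by (metis of_int_le_iff of_int_mult of_int_of_nat_eq)
  have "real_of_int (idx n v) \<le> real q * (real (M k) * v)" using idx_le(1)[of n v] by (simp add: Mn algebra_simps)
  also have "\<dots> \<le> real q * (real_of_int (idx k v) + 1)"
    using idx_le(2)[of k v] by (intro mult_left_mono) auto
  finally have "real_of_int (idx n v) \<le> real q * real_of_int (idx k u) + real q"
    using assms(2) by (simp add: algebra_simps)
  with 1 have "real_of_int (idx n v - idx n u) \<le> real q" by simp
  also have "\<dots> = M n / M k" using Mn by simp
  finally show ?thesis .
qed

section \<open>The jump function that parametrises the Cantor set\<close>

text \<open>A strictly increasing function whose term \<open>n\<close> jumps by
  \<open>gap n / M (n+1)\<close> at the positive multiples of \<open>1 / M (n+1)\<close>. The jumps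
  open the gaps of the Cantor set, which is the closure of the range; \<open>Phi\<close> will be a
  left inverse.\<close>

definition pos :: "real \<Rightarrow> real" where
  "pos u = (\<Sum>n. gap n * (idx (Suc n) u / M (Suc n)))"

lemma pos_term:
  assumes "u \<in> {0..1}"
  shows "0 \<le> gap n * (idx (Suc n) u / M (Suc n))" "gap n * (idx (Suc n) u / M (Suc n)) \<le> (1/2) ^ Suc n"
proof -
  have i: "0 \<le> real_of_int (idx (Suc n) u)" "real_of_int (idx (Suc n) u) \<le> M (Suc n)"
    using idx_bounds[OF assms, of "Suc n"] by linarith+
  then show "0 \<le> gap n * (idx (Suc n) u / M (Suc n))" by (simp add: less_imp_le)
  have "gap n * (idx (Suc n) u / M (Suc n)) \<le> gap n * 1"
    using i by (intro mult_left_mono) (auto simp: less_imp_le)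
  also have "\<dots> \<le> (1/2) ^ Suc n" using gap_le' by simp
  finally show "gap n * (idx (Suc n) u / M (Suc n)) \<le> (1/2) ^ Suc n" .
qed

lemma summable_pos:
  assumes "u \<in> {0..1}" shows "summable (\<lambda>n. gap n * (idx (Suc n) u / M (Suc n)))"
proof (rule summable_comparison_test')
  show "summable (\<lambda>n. (1/2::real) ^ Suc n)" using power_half_series by (rule sums_summable)
  show "norm (gap n * (idx (Suc n) u / M (Suc n))) \<le> (1/2) ^ Suc n" for n
    using pos_term[OF assms, of n] by simp
qed

lemma pos_bounds:
  assumes "u \<in> {0..1}" shows "pos u \<in> {0..1}"
proof -
  have "pos u \<le> (\<Sum>n. (1/2) ^ Suc n)"
    unfolding pos_def using pos_term[OF assms] sums_summable[OF power_half_series]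
    by (intro suminf_le summable_pos[OF assms]) auto
  then have "pos u \<le> 1" using sums_unique[OF power_half_series] by simp
  moreover have "0 \<le> pos u"
    unfolding pos_def using pos_term[OF assms] by (intro suminf_nonneg summable_pos[OF assms]) auto
  ultimately show ?thesis by simp
qed

lemma pos_0: "pos 0 = 0"
  by (simp add: pos_def idx_def)

lemma pos_diff:
  assumes "u \<in> {0..1}" "v \<in> {0..1}"
  shows "(\<lambda>n. gap n * ((idx (Suc n) v - idx (Suc n) u) / M (Suc n))) sums (pos v - pos u)"
proof -
  have "(\<lambda>n. gap n * (idx (Suc n) v / M (Suc n)) - gap n * (idx (Suc n) u / M (Suc n))) sums (pos v - pos u)"
    unfolding pos_def by (intro sums_diff summable_sums summable_pos assms)
  then show ?thesis by (simp add: diff_divide_distrib right_diff_distrib)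
qed

lemma pos_diff_ge:
  assumes "u \<in> {0..1}" "v \<in> {0..1}" "u \<le> v"
  shows "gap n * ((idx (Suc n) v - idx (Suc n) u) / M (Suc n)) \<le> pos v - pos u"
proof -
  let ?f = "\<lambda>n. gap n * ((idx (Suc n) v - idx (Suc n) u) / M (Suc n))"
  note sums = pos_diff[OF assms(1,2)]
  have "sum ?f {n} \<le> suminf ?f"
    using idx_mono[OF assms(3)]
    by (intro sum_le_suminf sums_summable[OF sums]) (auto simp: less_imp_le)
  then show ?thesis using sums_unique[OF sums] by simp
qed

text \<open>Every step to the next cell of level \<open>n+1\<close> costs a jump of
  \<open>gap n / M (n+1)\<close>; the term \<open>1 / M (n+1)\<close> accounts for rounding at both
  ends.\<close>

lemma pos_diff_ge':
  assumes "u \<in> {0..1}" "v \<in> {0..1}" "u \<le> v"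
  shows "v - u \<le> (pos v - pos u) / gap n + 1 / M (Suc n)"
proof -
  have "real (M (Suc n)) * v - real (M (Suc n)) * u \<le> real_of_int (idx (Suc n) v - idx (Suc n) u) + 1"
    using idx_le(2)[of "Suc n" v] idx_le(1)[of "Suc n" u] by simp
  then have "(real (M (Suc n)) * v - real (M (Suc n)) * u - 1) / M (Suc n)
      \<le> real_of_int (idx (Suc n) v - idx (Suc n) u) / M (Suc n)"
    by (intro divide_right_mono) auto
  then have "v - u - 1 / M (Suc n) \<le> real_of_int (idx (Suc n) v - idx (Suc n) u) / M (Suc n)"
    by (simp add: diff_divide_distrib)
  also have "\<dots> \<le> (pos v - pos u) / gap n"
    using pos_diff_ge[OF assms, of n] gap_pos[of n] by (simp add: field_simps)
  finally show ?thesis by simp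
qed

lemma pos_mono:
  assumes "u \<in> {0..1}" "v \<in> {0..1}" "u \<le> v" shows "pos u \<le> pos v"
proof -
  have "0 \<le> gap 0 * ((idx (Suc 0) v - idx (Suc 0) u) / M (Suc 0))"
    using idx_mono[OF assms(3)] by (simp add: less_imp_le)
  then show ?thesis using pos_diff_ge[OF assms, of 0] by linarith
qed

lemma eventually_M_inverse_less:
  assumes "e > 0" obtains n where "1 / M (Suc n) < e"
proof -
  have "(\<lambda>n. 1 / real (M n)) \<longlonglongrightarrow> 0"
    by (intro tendsto_divide_0[OF tendsto_const] filterlim_at_top_imp_at_infinity M_tendsto)
  then have "(\<lambda>n. 1 / real (M (Suc n))) \<longlonglongrightarrow> 0" by (rule LIMSEQ_Suc)
  then have "\<forall>\<^sub>F n in sequentially. 1 / real (M (Suc n)) < e"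
    using assms by (simp add: order_tendsto_iff)
  then show ?thesis using that by (auto simp: eventually_sequentially)
qed

lemma pos_strict_mono:
  assumes "u \<in> {0..1}" "v \<in> {0..1}" "u < v" shows "pos u < pos v"
proof (rule ccontr)
  assume "\<not> pos u < pos v"
  then have "pos v - pos u = 0" using pos_mono[OF assms(1,2)] assms(3) by simp
  moreover obtain n where "1 / M (Suc n) < v - u" using eventually_M_inverse_less assms(3) by (metis diff_gt_0_iff_gt)
  ultimately show False using pos_diff_ge'[OF assms(1,2), of n] assms(3) by simp
qed

text \<open>Terms below \<open>k\<close> vanish because the coarser indices agree too. For
  \<open>n \<ge> k\<close>, one cell of level \<open>k\<close> carries at most a share
  \<open>1 / M k\<close> of \<open>gap n\<close>, and \<open>rho n * M n\<close> does not increase,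
  so the term is at most \<open>(1/2) ^ (n+1) * rho k\<close>. The form of \<open>gap\<close> is
  made for this sum.\<close>

lemma pos_osc:
  assumes "u \<in> {0..1}" "v \<in> {0..1}" "idx k u = idx k v"
  shows "pos v - pos u \<le> rho k"
proof -
  have le: "gap n * ((idx (Suc n) v - idx (Suc n) u) / M (Suc n)) \<le> (1/2) ^ Suc n * rho k" for n
  proof (cases "k \<le> n")
    case True
    have "real_of_int (idx (Suc n) v - idx (Suc n) u) \<le> M (Suc n) / M k"
      using True by (intro idx_finer assms) simp
    then have "real_of_int (idx (Suc n) v - idx (Suc n) u) / M (Suc n) \<le> M (Suc n) / M k / M (Suc n)"
      by (intro divide_right_mono) auto
    also have "\<dots> = 1 / M k" by simp
    finally have "real_of_int (idx (Suc n) v - idx (Suc n) u) / M (Suc n) \<le> 1 / M k" .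
    then have "gap n * (real_of_int (idx (Suc n) v - idx (Suc n) u) / M (Suc n)) \<le> gap n * (1 / M k)"
      by (intro mult_left_mono) (auto simp: less_imp_le)
    also have "\<dots> \<le> (1/2) ^ Suc n * (rho k * M k) * (1 / M k)"
      using gap_le[OF True] by (intro mult_right_mono) auto
    also have "\<dots> = (1/2) ^ Suc n * rho k" by simp
    finally show ?thesis by simp
  next
    case False
    then have "idx (Suc n) u = idx (Suc n) v" by (intro idx_coarser[OF _ assms(3)]) simp
    then show ?thesis by (simp add: less_imp_le)
  qed
  have "(\<lambda>n. (1/2) ^ Suc n * rho k) sums (1 * rho k)"
    by (intro sums_mult2 power_half_series)
  from sums_le[OF le pos_diff[OF assms(1,2)] this] show ?thesis by simp
qed

section \<open>The Cantor function and its core\<close>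

text \<open>A generalised inverse of \<open>pos\<close>: the supremum makes sense also inside the
  gaps of the range, where it is constant.\<close>

definition Phi :: "real \<Rightarrow> real" where
  "Phi x = Sup {u \<in> {0..1}. pos u \<le> x}"

lemma Phi_set:
  assumes "0 \<le> x"
  shows "{u \<in> {0..1}. pos u \<le> x} \<noteq> {}" "bdd_above {u \<in> {0..1}. pos u \<le> x}"
  using assms pos_0 by (auto intro!: exI[of _ 0] bdd_aboveI[of _ 1])

lemma Phi_pos:
  assumes "u \<in> {0..1}" shows "Phi (pos u) = u"
  unfolding Phi_def
proof (rule cSup_eq_maximum)
  show "u \<in> {v \<in> {0..1}. pos v \<le> pos u}" using assms by simp
  show "v \<le> u" if "v \<in> {v \<in> {0..1}. pos v \<le> pos u}" for v
  proof (rule ccontr)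
    assume "\<not> v \<le> u"
    then have "pos u < pos v" using that by (intro pos_strict_mono assms) auto
    with that show False by simp
  qed
qed

lemma Phi_bounds:
  assumes "0 \<le> x" shows "Phi x \<in> {0..1}"
proof -
  have "0 \<le> Phi x" unfolding Phi_def
    using assms pos_0 by (intro cSup_upper Phi_set) auto
  moreover have "Phi x \<le> 1" unfolding Phi_def
    using assms by (intro cSup_least Phi_set) auto
  ultimately show ?thesis by simp
qed

lemma Phi_mono:
  assumes "0 \<le> x" "x \<le> y" shows "Phi x \<le> Phi y"
  unfolding Phi_def using assms by (intro cSup_subset_mono Phi_set) auto

lemma Phi_eqI:
  assumes "x \<le> y" "\<And>u. u \<in> {0..1} \<Longrightarrow> x < pos u \<Longrightarrow> pos u \<le> y \<Longrightarrow> False"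
  shows "Phi x = Phi y"
proof -
  have "{u \<in> {0..1}. pos u \<le> x} = {u \<in> {0..1}. pos u \<le> y}"
    using assms by (auto simp: not_le[symmetric] intro: order_trans)
  then show ?thesis by (simp add: Phi_def)
qed

text \<open>The inverse form of \<open>pos_diff_ge'\<close>. The second term is small for large
  \<open>n\<close>, the first for close points once \<open>n\<close> is fixed, which gives
  continuity.\<close>

lemma Phi_diff:
  assumes "0 \<le> x" "x \<le> y"
  shows "Phi y - Phi x \<le> (y - x) / gap n + 1 / M (Suc n)"
proof -
  let ?B = "(y - x) / gap n + 1 / M (Suc n)"
  have "Phi y \<le> Phi x + ?B"
    unfolding Phi_def[of y]
  proof (rule cSup_least)
    show "{u \<in> {0..1}. pos u \<le> y} \<noteq> {}" using assms by (intro Phi_set) simp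
    fix v assume v: "v \<in> {u \<in> {0..1}. pos u \<le> y}"
    show "v \<le> Phi x + ?B"
    proof (cases "v \<le> Phi x")
      case True
      moreover have "0 \<le> ?B" using assms by (simp add: less_imp_le)
      ultimately show ?thesis by linarith
    next
      case False
      \<comment> \<open>Every admissible \<open>u > Phi x\<close> has \<open>pos u > x\<close> by
        the supremum; letting \<open>u\<close> decrease to \<open>Phi x\<close> avoids asking about
        \<open>pos (Phi x)\<close>.\<close>
      have "v - ?B \<le> Phi x"
      proof (rule dense_ge_bounded)
        show "Phi x < v" using False by simp
        fix u assume u: "Phi x < u" "u < v"
        have u01: "u \<in> {0..1}" using u v Phi_bounds[OF assms(1)] by auto
        have "\<not> pos u \<le> x"
        proof
          assume "pos u \<le> x"
          then have "u \<le> Phi x" unfolding Phi_def using u01 assms by (intro cSup_upper Phi_set) auto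
          with u show False by simp
        qed
        then have "(pos v - pos u) / gap n \<le> (y - x) / gap n"
          using v by (intro divide_right_mono) (auto simp: less_imp_le)
        then show "v - ?B \<le> u" using pos_diff_ge'[OF u01, of v n] v u by simp
      qed
      then show ?thesis by simp
    qed
  qed
  then show ?thesis by simp
qed

lemma Phi_continuous: "continuous_on {0..1} Phi"
  unfolding continuous_on_iff
proof (intro ballI allI impI)
  fix x e :: real assume x: "x \<in> {0..1}" and e: "0 < e"
  then obtain n where n: "1 / M (Suc n) < e / 2" using eventually_M_inverse_less[of "e/2"] by auto
  show "\<exists>d>0. \<forall>x'\<in>{0..1}. dist x' x < d \<longrightarrow> dist (Phi x') (Phi x) < e"
  proof (intro exI[of _ "gap n * e / 2"] conjI ballI impI)
    fix y assume y: "y \<in> {0..1}" "dist y x < gap n * e / 2"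
    have *: "\<bar>y - x\<bar> / gap n < e / 2" using y(2) gap_pos[of n] by (simp add: dist_real_def field_simps)
    have n': "\<bar>y - x\<bar> / gap n + 1 / M (Suc n) < e" using * n by linarith
    show "dist (Phi y) (Phi x) < e"
    proof (cases "x \<le> y")
      case True
      then show ?thesis
        using Phi_diff[of x y n] Phi_mono[of x y] x n' True by (simp add: dist_real_def)
    next
      case False
      then show ?thesis
        using Phi_diff[of y x n] Phi_mono[of y x] y n' False by (simp add: dist_real_def)
    qed
  qed (use e in simp)
qed

text \<open>The Cantor set; off it \<^const>\<open>Phi\<close> is locally constant.\<close>

definition core :: "real set" where
  "core = {x \<in> {0..1}. \<forall>e>0. \<exists>u\<in>{0..1}. \<bar>pos u - x\<bar> < e}"

text \<open>\<open>pos\<close> maps each cell of level \<open>n\<close> into an interval of length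
  \<open>rho n\<close> by \<open>pos_osc\<close>, so these intervals cover the range; a finite union
  of closed intervals also contains the limit points.\<close>

lemma core_cover: "core \<subseteq> (\<Union>j<Suc (M n). {pos (j / M n)..pos (j / M n) + rho n})"
proof
  fix x assume x: "x \<in> core"
  let ?U = "\<Union>j<Suc (M n). {pos (j / M n)..pos (j / M n) + rho n}"
  have in_U: "pos u \<in> ?U" if u: "u \<in> {0..1}" for u
  proof -
    define j where "j = nat (idx n u)"
    have j: "real j = idx n u" "j < Suc (M n)" using idx_bounds[OF u, of n] by (auto simp: j_def)
    have j01: "j / M n \<in> {0..1}" using j(2) by (simp add: divide_le_eq_1)
    have "idx n (real_of_int i / M n) = i" for i by (simp add: idx_def)
    then have "idx n (j / M n) = idx n u" using j(1) by simp
    then have "pos u - pos (j / M n) \<le> rho n" using pos_osc[OF j01 u] by simp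
    moreover have "j / M n \<le> u" using idx_le(1)[of n u] j(1) by (simp add: field_simps)
    then have "pos (j / M n) \<le> pos u" using pos_mono[OF j01 u] by simp
    ultimately have "pos u \<in> {pos (j / M n)..pos (j / M n) + rho n}" by simp
    then show ?thesis using j(2) by blast
  qed
  have "x \<in> closure ?U"
    unfolding closure_approachable dist_real_def using x in_U unfolding core_def by blast
  moreover have "closed ?U" by (intro closed_UN) auto
  ultimately show "x \<in> ?U" by (simp only: closure_closed)
qed

lemma hnull_core_strip:
  fixes b :: real
  assumes "s < t" "0 \<le> b"
  shows "hnull t (core \<times> {-b..b})"
proof (rule hnull_strip[OF assms(2)])
  fix d e :: real assume de: "d > 0" "e > 0"
  \<comment> \<open>Collects \<open>Suc (M n) \<le> 2 * M n\<close> and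
    \<open>2 * b / \<rho> + 1 \<le> (2 * b + 1) / \<rho>\<close> for \<open>\<rho> \<le> 1\<close>;
    the remaining \<open>M n * rho n powr (t - 1)\<close> equals
    \<open>rho n powr (t - s)\<close>.\<close>
  define C where "C = 2 * (2 * b + 1) * 2 powr t"
  have "(\<lambda>n. C * rho n powr (t - s)) \<longlonglongrightarrow> C * 0"
    using assms(1) rho_tendsto by (intro tendsto_mult tendsto_const tendsto_zero_powrI[OF _ tendsto_const])
       (auto intro!: always_eventually)
  then have "\<forall>\<^sub>F n in sequentially. C * rho n powr (t - s) < e"
    using de by (simp add: order_tendsto_iff)
  moreover have "\<forall>\<^sub>F n in sequentially. rho n < d / 2"
    using order_tendstoD(2)[OF rho_tendsto, of "d / 2"] de by simp
  ultimately have "\<forall>\<^sub>F n in sequentially. C * rho n powr (t - s) < e \<and> rho n < d / 2"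
    by eventually_elim auto
  then obtain n where n: "C * rho n powr (t - s) < e" "rho n < d / 2"
    by (auto simp: eventually_sequentially)
  have rho1: "rho n \<le> 1"
  proof -
    have "rho n \<le> 1 / M n" by (rule rho_le_inverse)
    also have "\<dots> \<le> 1" by simp
    finally show ?thesis .
  qed
  have "real (Suc (M n)) * (2 * b / rho n + 1) * (2 * rho n) powr t
     \<le> (2 * M n) * ((2 * b + 1) / rho n) * (2 powr t * rho n powr t)"
  proof (intro mult_mono)
    show "real (Suc (M n)) \<le> 2 * M n" using M_ge1[of n] by simp
    show "2 * b / rho n + 1 \<le> (2 * b + 1) / rho n" using rho1 by (simp add: add_divide_distrib)
  qed (use assms in \<open>auto simp: powr_mult less_imp_le\<close>)
  also have "\<dots> = C * (M n * (rho n powr t / rho n))" by (simp add: C_def)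
  also have "M n * (rho n powr t / rho n) = rho n powr (t - s)"
  proof -
    have "rho n powr t = rho n powr ((t - s) + (s - 1) + 1)" by simp
    also have "\<dots> = rho n powr (t - s) * rho n powr (s - 1) * rho n"
      unfolding powr_add by simp
    also have "\<dots> = rho n powr (t - s) * rho n / M n" by (simp add: rho_powr)
    finally show ?thesis by simp
  qed
  finally have "real (Suc (M n)) * (2 * b / rho n + 1) * (2 * rho n) powr t < e" using n(1) by simp
  then show "\<exists>(N::nat) \<rho> p. 0 < \<rho> \<and> 2 * \<rho> \<le> d \<and> core \<subseteq> (\<Union>i<N. {p i..p i + \<rho>})
        \<and> real N * (2 * b / \<rho> + 1) * (2 * \<rho>) powr t < e"
    using n(2) core_cover[of n]
    by (intro exI[of _ "Suc (M n)"] exI[of _ "rho n"] exI[of _ "\<lambda>j. pos (j / M n)"]) auto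
qed (use assms s in auto)

lemma hnull_graph_add_Phi:
  assumes w: "w \<in> C01" "hnull t (graph01 w)" and F: "F \<in> C01" and t: "s < t"
    and const: "\<And>x y. x \<in> {0..1} \<Longrightarrow> y \<in> {0..1} \<Longrightarrow> Phi x = Phi y \<Longrightarrow> F x = F y"
  shows "hnull t (graph01 (w + F))"
proof -
  have wF: "w + F \<in> C01" using w F fs.subspace_add[OF subspace_C01] by blast
  obtain b where b: "b > 0" "\<And>x. \<bar>(w + F) x\<bar> \<le> b" using C01_bounded[OF wF] by blast
  \<comment> \<open>Rational intervals that miss the range of \<open>pos\<close>: countably many,
    with \<open>Phi\<close> and hence \<open>F\<close> constant on each, and together they cover the
    unit interval off the core.\<close>
  define I where "I = {(p :: rat, q :: rat). \<forall>u\<in>{0..1}. pos u \<notin> {of_rat p<..<of_rat q}}"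
  define P where "P = (\<lambda>(p, q). (\<lambda>x. (x, (w + F) x)) ` ({0..1} \<inter> {of_rat p<..<of_rat q :: real}))"
  have "hnull t (\<Union>i\<in>I. P i)"
  proof (rule hnull_countable_UN)
    show "countable I" by simp
    fix i assume i: "i \<in> I"
    obtain p q where pq: "i = (p, q)" by (cases i)
    define X where "X = {0..1} \<inter> {of_rat p<..<of_rat q :: real}"
    have ordered: "Phi x = Phi y" if xy: "x \<in> X" "y \<in> X" "x \<le> y" for x y
    proof (rule Phi_eqI[OF xy(3)])
      fix u assume u: "u \<in> {0..1}" "x < pos u" "pos u \<le> y"
      then have "pos u \<in> {of_rat p<..<of_rat q}" using xy by (auto simp: X_def)
      then show False using i u(1) by (auto simp: I_def pq)
    qed
    have F_const: "F x = F y" if "x \<in> X" "y \<in> X" for x y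
    proof (rule const)
      show "x \<in> {0..1}" "y \<in> {0..1}" using that by (simp_all add: X_def)
      show "Phi x = Phi y"
      proof (cases "x \<le> y")
        case True
        then show ?thesis by (rule ordered[OF that])
      next
        case False
        then show ?thesis by (intro ordered[OF that(2,1), symmetric]) simp
      qed
    qed
    obtain c where c: "\<And>x. x \<in> X \<Longrightarrow> F x = c"
    proof (cases "X = {}")
      case False
      then obtain y where "y \<in> X" by blast
      then show ?thesis using that F_const by blast
    qed (use that in auto)
    have "P i = (\<lambda>z. z + (0, c)) ` ((\<lambda>x. (x, w x)) ` X)"
      using c by (auto simp: P_def pq X_def[symmetric] image_image)
    moreover have "hnull t ((\<lambda>z. z + (0, c)) ` ((\<lambda>x. (x, w x)) ` X))"
    proof (rule hnull_lipschitz_image[where C = 1])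
      show "hnull t ((\<lambda>x. (x, w x)) ` X)"
        by (rule hnull_subset[OF w(2)]) (auto simp: graph01_def X_def)
    qed (use t s in \<open>auto simp: dist_norm\<close>)
    ultimately show "hnull t (P i)" by simp
  qed
  moreover have "hnull t (core \<times> {-b..b})" using b t by (intro hnull_core_strip) auto
  ultimately have "hnull t ((\<Union>i\<in>I. P i) \<union> core \<times> {-b..b})" by (rule hnull_Un)
  moreover have "graph01 (w + F) \<subseteq> (\<Union>i\<in>I. P i) \<union> core \<times> {-b..b}"
  proof
    fix z assume "z \<in> graph01 (w + F)"
    then obtain x where x: "x \<in> {0..1}" "z = (x, (w + F) x)" by (auto simp: graph01_def)
    show "z \<in> (\<Union>i\<in>I. P i) \<union> core \<times> {-b..b}"
    proof (cases "x \<in> core")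
      case True
      have "-b \<le> (w + F) x" "(w + F) x \<le> b" using b(2)[of x] by linarith+
      then have "(w + F) x \<in> {-b..b}" by (simp only: atLeastAtMost_iff)
      with True show ?thesis using x(2) by blast
    next
      case False
      then obtain e where e: "e > 0" "\<And>u. u \<in> {0..1} \<Longrightarrow> e \<le> \<bar>pos u - x\<bar>"
        using x(1) by (auto simp: core_def not_less)
      obtain p :: rat where p: "x - e < of_rat p" "of_rat p < x" using of_rat_dense[of "x - e" x] e(1) by auto
      obtain q :: rat where q: "x < of_rat q" "of_rat q < x + e" using of_rat_dense[of x "x + e"] e(1) by auto
      have "(p, q) \<in> I" unfolding I_def using e(2) p q by fastforce
      moreover have "z \<in> P (p, q)" using x p q by (auto simp: P_def)
      ultimately show ?thesis by blast
    qed
  qed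
  ultimately show ?thesis by (rule hnull_subset)
qed

end

subsection \<open>Lower bound for the dimension\<close>

lemma card_int_set_le:
  fixes J :: "int set"
  assumes fin: "finite J" and D: "0 \<le> D" "\<And>i j. i \<in> J \<Longrightarrow> j \<in> J \<Longrightarrow> real_of_int (j - i) \<le> D"
  shows "real (card J) \<le> D + 1"
proof (cases "J = {}")
  case False
  have "J \<subseteq> {Min J..Min J + \<lfloor>D\<rfloor>}"
  proof
    fix j assume j: "j \<in> J"
    then have "real_of_int (j - Min J) \<le> D" using False fin by (intro D) auto
    then have "j - Min J \<le> \<lfloor>D\<rfloor>" by (simp only: le_floor_iff)
    then show "j \<in> {Min J..Min J + \<lfloor>D\<rfloor>}" using fin j by simp
  qed
  then have "card J \<le> card {Min J..Min J + \<lfloor>D\<rfloor>}" by (intro card_mono) auto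
  also have "\<dots> = nat (\<lfloor>D\<rfloor> + 1)" by simp
  finally have "real (card J) \<le> real (nat (\<lfloor>D\<rfloor> + 1))" by (simp only: of_nat_le_iff)
  also have "\<dots> = real_of_int \<lfloor>D\<rfloor> + 1" using D(1) by simp
  also have "\<dots> \<le> D + 1" by simp
  finally show ?thesis .
qed (use D in simp)

section \<open>Triangle waves and their series\<close>

definition tri :: "real \<Rightarrow> real" where "tri v = infdist v \<int>"

lemma tri_nonneg: "0 \<le> tri v"
  by (simp add: tri_def infdist_nonneg)

lemma tri_le1: "tri v \<le> 1"
proof -
  have "tri v \<le> dist v (of_int \<lfloor>v\<rfloor>)" unfolding tri_def by (intro infdist_le) auto
  also have "\<dots> \<le> 1" by (simp add: dist_real_def) linarith
  finally show ?thesis .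
qed

lemma tri_lipschitz: "\<bar>tri u - tri v\<bar> \<le> \<bar>u - v\<bar>"
  unfolding tri_def using infdist_triangle_abs[of u \<int> v] by (simp add: dist_real_def)

lemma tri_Ints: "v \<in> \<int> \<Longrightarrow> tri v = 0"
  by (simp add: tri_def)

lemma tri_eqI:
  assumes "\<And>k :: int. d \<le> \<bar>v - of_int k\<bar>" "d = \<bar>v - of_int j\<bar>"
  shows "tri v = d"
proof (rule antisym)
  show "tri v \<le> d" unfolding tri_def assms(2)
    using infdist_le[of "of_int j" \<int> v] by (simp add: dist_real_def)
  show "d \<le> tri v" unfolding tri_def infdist_def
    using assms(1) by (auto intro!: cINF_greatest simp: dist_real_def elim!: Ints_cases)
qed

text \<open>On each half period the wave has slope 1 or -1 and preserves distances, so closeness of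
  values forces closeness of arguments; \<open>card_idx_step\<close> rests on this.\<close>

lemma tri_left:
  assumes "of_int i \<le> v" "v \<le> of_int i + 1/2"
  shows "tri v = v - of_int i"
proof (rule tri_eqI[of _ _ i])
  fix k :: int
  consider "k \<le> i" | "i + 1 \<le> k" by linarith
  then show "v - of_int i \<le> \<bar>v - of_int k\<bar>"
  proof cases
    case 1
    then have "real_of_int k \<le> of_int i" by simp
    then show ?thesis using assms by linarith
  next
    case 2
    then have "real_of_int i + 1 \<le> of_int k" by linarith
    then show ?thesis using assms by linarith
  qed
qed (use assms in simp)

lemma tri_right:
  assumes "of_int i + 1/2 \<le> v" "v \<le> of_int i + 1"
  shows "tri v = of_int i + 1 - v"
proof (rule tri_eqI[of _ _ "i + 1"])
  fix k :: int
  consider "k \<le> i" | "i + 1 \<le> k" by linarith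
  then show "of_int i + 1 - v \<le> \<bar>v - of_int k\<bar>"
  proof cases
    case 1
    then have "real_of_int k \<le> of_int i" by simp
    then show ?thesis using assms by linarith
  next
    case 2
    then have "real_of_int i + 1 \<le> of_int k" by linarith
    then show ?thesis using assms by linarith
  qed
qed (use assms in simp)

context cantor_scale
begin

text \<open>Levels below \<open>k\<close> are dropped so that the series vanishes at the multiples
  of \<open>1 / M k\<close> and can be cut off there continuously.\<close>

definition osc :: "nat \<Rightarrow> real \<Rightarrow> real" where
  "osc k u = (\<Sum>n. (if k \<le> n then amp n else 0) * tri (real (M n) * u))"

lemma osc_term_le: "(if k \<le> n then amp n else 0) * tri (real (M n) * u) \<le> amp n"
  using amp_pos[of n] tri_le1 tri_nonneg by (auto simp: mult_left_le less_imp_le)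

lemma osc_term_nonneg: "0 \<le> (if k \<le> n then amp n else 0) * tri (real (M n) * u)"
  using amp_pos[of n] tri_nonneg by (auto simp: less_imp_le)

lemma summable_amp: "summable (\<lambda>n. amp (m + n))"
proof (rule summable_comparison_test')
  show "summable (\<lambda>n. amp m * (1/2) ^ n)" by (intro summable_mult summable_geometric) auto
  show "norm (amp (m + n)) \<le> amp m * (1/2) ^ n" for n
    using amp_add_le[of m n] by (simp only: real_norm_def abs_of_pos amp_pos)
qed

lemma suminf_amp_le: "(\<Sum>n. amp (m + n)) \<le> 2 * amp m"
proof -
  have "(\<Sum>n. amp (m + n)) \<le> (\<Sum>n. amp m * (1/2) ^ n)"
    by (intro suminf_le amp_add_le summable_amp summable_mult summable_geometric) auto
  also have "\<dots> = amp m * 2" by (subst suminf_mult) (auto simp: suminf_geometric)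
  finally show ?thesis by simp
qed

lemma summable_osc: "summable (\<lambda>n. (if k \<le> n then amp n else 0) * tri (real (M n) * u))"
proof (rule summable_comparison_test')
  show "summable amp" using summable_amp[of 0] by simp
  show "norm ((if k \<le> n then amp n else 0) * tri (real (M n) * u)) \<le> amp n" for n
    using osc_term_le osc_term_nonneg by simp
qed

lemma osc_nonneg: "0 \<le> osc k u"
  unfolding osc_def by (intro suminf_nonneg summable_osc osc_term_nonneg)

lemma osc_ge_term: "amp k * tri (real (M k) * u) \<le> osc k u"
proof -
  have "(\<Sum>n\<in>{k}. (if k \<le> n then amp n else 0) * tri (real (M n) * u)) \<le> osc k u"
    unfolding osc_def by (intro sum_le_suminf summable_osc osc_term_nonneg) auto
  then show ?thesis by simp
qed

lemma osc_le: "osc k u \<le> 2 * amp k"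
proof -
  have "osc k u = (\<Sum>n. (if k \<le> n + k then amp (n + k) else 0) * tri (real (M (n + k)) * u))
      + (\<Sum>n<k. (if k \<le> n then amp n else 0) * tri (real (M n) * u))"
    unfolding osc_def by (rule suminf_split_initial_segment[OF summable_osc])
  also have "(\<Sum>n<k. (if k \<le> n then amp n else 0) * tri (real (M n) * u)) = 0"
    by (intro sum.neutral) auto
  also have "(\<Sum>n. (if k \<le> n + k then amp (n + k) else 0) * tri (real (M (n + k)) * u)) \<le> (\<Sum>n. amp (k + n))"
  proof (rule suminf_le)
    show "summable (\<lambda>n. (if k \<le> n + k then amp (n + k) else 0) * tri (real (M (n + k)) * u))"
      using summable_osc[of k u] by (rule summable_ignore_initial_segment)
    show "(if k \<le> n + k then amp (n + k) else 0) * tri (real (M (n + k)) * u) \<le> amp (k + n)" for n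
      using osc_term_le[of k "n + k" u] by (simp add: add.commute)
  qed (rule summable_amp)
  also have "\<dots> \<le> 2 * amp k" by (rule suminf_amp_le)
  finally show ?thesis by simp
qed

lemma osc_eq_0:
  assumes "real (M k) * u \<in> \<int>" shows "osc k u = 0"
proof -
  have zero: "(if k \<le> n then amp n else 0) * tri (real (M n) * u) = 0" for n
  proof (cases "k \<le> n")
    case True
    then obtain q where "M n = M k * q" using M_dvd_le by (auto simp: dvd_def)
    then have "real (M n) * u = real q * (real (M k) * u)" by simp
    then have "real (M n) * u \<in> \<int>" using assms by (metis Ints_mult Ints_of_nat)
    then show ?thesis by (simp add: tri_Ints)
  qed simp
  show ?thesis unfolding osc_def zero by simp
qed

lemma continuous_on_tri: "continuous_on A (\<lambda>u. tri (c * u))"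
  unfolding tri_def by (intro continuous_intros)

lemma osc_continuous: "continuous_on UNIV (osc k)"
proof -
  have "uniform_limit UNIV (\<lambda>n u. \<Sum>i<n. (if k \<le> i then amp i else 0) * tri (real (M i) * u))
      (\<lambda>u. \<Sum>i. (if k \<le> i then amp i else 0) * tri (real (M i) * u)) sequentially"
  proof (rule Weierstrass_m_test)
    show "summable amp" using summable_amp[of 0] by simp
    show "norm ((if k \<le> n then amp n else 0) * tri (real (M n) * u)) \<le> amp n" for n u
      using osc_term_le osc_term_nonneg by simp
  qed
  then have "continuous_on UNIV (\<lambda>u. \<Sum>i. (if k \<le> i then amp i else 0) * tri (real (M i) * u))"
    by (rule uniform_limit_theorem[rotated])
       (auto intro!: always_eventually continuous_intros continuous_on_tri)
  then show ?thesis by (simp add: osc_def[abs_def])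
qed

lemma idx_eq_diff:
  assumes "idx l u = idx l v" shows "\<bar>u - v\<bar> \<le> 1 / M l"
proof -
  have "\<bar>real (M l) * u - real (M l) * v\<bar> \<le> 1"
    using idx_le[of l u] idx_le[of l v] assms by linarith
  then have "real (M l) * \<bar>u - v\<bar> \<le> 1" by (simp add: right_diff_distrib[symmetric] abs_mult)
  then show ?thesis by (simp add: pos_le_divide_eq mult.commute)
qed

text \<open>\<open>amp n * M n\<close> is a Lipschitz constant of term \<open>n\<close> and
  \<open>1 / M l\<close> the width of a cell. With \<open>l = m + 1\<close>, the factor
  \<open>2 ^ ((m+3)^3)\<close> gained in the last step beats both the number of terms and
  \<open>1 / amp (l+1)\<close>.\<close>

lemma coarse_sum_le: "(\<Sum>n<l. amp n * (M n / M l)) \<le> amp (Suc l)"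
proof (cases l)
  case 0
  then show ?thesis by (simp add: less_imp_le)
next
  case (Suc m)
  have "amp n * (M n / M l) \<le> 1 / 2 ^ ((m + 3) ^ 3)" if "n < l" for n
  proof -
    have "M n \<le> M m" using that Suc by (intro M_le) simp
    then have "2 ^ ((m + 3) ^ 3) * M n \<le> 2 ^ ((m + 3) ^ 3) * M m" by simp
    also have "\<dots> \<le> M l" using M_growth[of m] Suc by simp
    finally have "real (2 ^ ((m + 3) ^ 3) * M n) \<le> real (M l)" by (simp only: of_nat_le_iff)
    then have "real (M n) / real (M l) \<le> 1 / 2 ^ ((m + 3) ^ 3)"
      by (simp add: pos_divide_le_eq pos_le_divide_eq mult.commute)
    moreover have "amp n * (M n / M l) \<le> 1 * (M n / M l)"
      by (intro mult_right_mono amp_le1) auto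
    ultimately show ?thesis by simp
  qed
  then have "(\<Sum>n<l. amp n * (M n / M l)) \<le> (\<Sum>n<l. 1 / 2 ^ ((m + 3) ^ 3))"
    by (intro sum_mono) auto
  also have "\<dots> = real l * (1/2) ^ ((m + 3) ^ 3)" by (simp add: power_one_over)
  also have "\<dots> \<le> 2 ^ l * (1/2) ^ (l + (Suc l)\<^sup>2)"
  proof (intro mult_mono power_decreasing)
    show "real l \<le> 2 ^ l" using of_nat_less_two_power[of l, where 'a = real] by simp
    have "l + (Suc l)\<^sup>2 \<le> (m + 3) * (m + 3)\<^sup>2"
      by (simp add: Suc power2_eq_square algebra_simps)
    then show "l + (Suc l)\<^sup>2 \<le> (m + 3) ^ 3" by (simp add: power3_eq_cube power2_eq_square)
  qed auto
  also have "\<dots> = amp (Suc l)" by (simp add: amp_def power_add power_one_over)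
  finally show ?thesis .
qed

text \<open>Within one cell of level \<open>l\<close> only the wave of level \<open>l\<close>
  matters: the finer ones contribute at most the tail \<open>2 * amp (l+1)\<close>, the coarser ones
  are nearly constant and contribute \<open>amp (l+1)\<close>.\<close>

lemma osc_diff:
  assumes "k \<le> l" "idx l u = idx l v"
  shows "\<bar>osc k u - osc k v - amp l * (tri (real (M l) * u) - tri (real (M l) * v))\<bar> \<le> 3 * amp (Suc l)"
proof -
  define c where "c n = (if k \<le> n then amp n else 0)" for n
  have c: "0 \<le> c n" "c n \<le> amp n" for n by (auto simp: c_def less_imp_le)
  define f where "f n = c n * (tri (real (M n) * u) - tri (real (M n) * v))" for n
  have f_sums: "f sums (osc k u - osc k v)"
    unfolding f_def right_diff_distrib c_def osc_def by (intro sums_diff summable_sums summable_osc)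
  have f_le: "\<bar>f n\<bar> \<le> amp n" for n
  proof -
    have "\<bar>tri (real (M n) * u) - tri (real (M n) * v)\<bar> \<le> 1"
      using tri_nonneg[of "real (M n) * u"] tri_nonneg[of "real (M n) * v"]
        tri_le1[of "real (M n) * u"] tri_le1[of "real (M n) * v"] by linarith
    then have "\<bar>f n\<bar> \<le> amp n * 1"
      unfolding f_def abs_mult using c[of n] by (intro mult_mono) auto
    then show ?thesis by simp
  qed
  have "osc k u - osc k v = (\<Sum>n. f (n + Suc l)) + (\<Sum>n<Suc l. f n)"
    using suminf_split_initial_segment[OF sums_summable[OF f_sums], of "Suc l"] sums_unique[OF f_sums] by simp
  moreover have "\<bar>\<Sum>n. f (n + Suc l)\<bar> \<le> 2 * amp (Suc l)"
  proof -
    have "norm (f (n + Suc l)) \<le> amp (Suc l + n)" for n using f_le[of "n + Suc l"] by (simp add: add.commute)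
    then have "norm (\<Sum>n. f (n + Suc l)) \<le> (\<Sum>n. amp (Suc l + n))"
      by (rule norm_suminf_le[OF _ summable_amp])
    also have "\<dots> \<le> 2 * amp (Suc l)" by (rule suminf_amp_le)
    finally show ?thesis by simp
  qed
  moreover have "\<bar>\<Sum>n<l. f n\<bar> \<le> amp (Suc l)"
  proof -
    have "\<bar>f n\<bar> \<le> amp n * (M n / M l)" for n
    proof -
      have "\<bar>tri (real (M n) * u) - tri (real (M n) * v)\<bar> \<le> \<bar>real (M n) * u - real (M n) * v\<bar>"
        by (rule tri_lipschitz)
      also have "\<dots> = M n * \<bar>u - v\<bar>" by (simp add: right_diff_distrib[symmetric] abs_mult)
      also have "\<dots> \<le> M n * (1 / M l)" using idx_eq_diff[OF assms(2)] by (intro mult_left_mono) auto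
      finally show ?thesis
        unfolding f_def abs_mult using c[of n] by (intro mult_mono) auto
    qed
    then have "\<bar>\<Sum>n<l. f n\<bar> \<le> (\<Sum>n<l. amp n * (M n / M l))"
      by (intro order.trans[OF sum_abs] sum_mono)
    also have "\<dots> \<le> amp (Suc l)" by (rule coarse_sum_le)
    finally show ?thesis .
  qed
  moreover have "f l = amp l * (tri (real (M l) * u) - tri (real (M l) * v))"
    using assms(1) by (simp add: f_def c_def)
  ultimately show ?thesis by simp
qed

section \<open>Counting the cells met by a set of small diameter\<close>

lemma finite_idx:
  assumes "S \<subseteq> {0..1}" shows "finite (idx n ` S)"
proof (rule finite_subset)
  show "idx n ` S \<subseteq> {0..int (M n)}"
  proof
    fix i assume "i \<in> idx n ` S"
    then obtain u where "u \<in> {0..1}" "i = idx n u" using assms by blast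
    then show "i \<in> {0..int (M n)}" using idx_bounds[of u n] by simp
  qed
qed simp

text \<open>Horizontal count: by \<open>pos_diff_ge\<close>, each further cell of level
  \<open>n+1\<close> needs room \<open>gap n / M (n+1)\<close>.\<close>

lemma card_idx_pos:
  assumes S: "S \<subseteq> {0..1}" and r: "0 \<le> r" "\<And>u v. u \<in> S \<Longrightarrow> v \<in> S \<Longrightarrow> \<bar>pos u - pos v\<bar> \<le> r"
  shows "real (card (idx (Suc n) ` S)) \<le> r / gap n * M (Suc n) + 1"
proof (rule card_int_set_le[OF finite_idx[OF S]])
  show "0 \<le> r / gap n * M (Suc n)" using r(1) by (simp add: less_imp_le)
  fix i j assume "i \<in> idx (Suc n) ` S" "j \<in> idx (Suc n) ` S"
  then obtain u v where uv: "u \<in> S" "v \<in> S" "i = idx (Suc n) u" "j = idx (Suc n) v" by blast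
  show "real_of_int (j - i) \<le> r / gap n * M (Suc n)"
  proof (cases "u \<le> v")
    case True
    have "gap n * (real_of_int (j - i) / M (Suc n)) \<le> pos v - pos u"
      unfolding uv using uv(1,2) S True by (intro pos_diff_ge) auto
    also have "\<dots> \<le> r" using r(2)[OF uv(1,2)] by simp
    finally have "real_of_int (j - i) / M (Suc n) \<le> r / gap n"
      using gap_pos[of n] by (simp only: pos_le_divide_eq mult.commute)
    then show ?thesis by (simp only: pos_divide_le_eq M_real_pos)
  next
    case False
    then have "j \<le> i" unfolding uv by (intro idx_mono) simp
    then have "real_of_int (j - i) \<le> 0" by simp
    also have "0 \<le> r / gap n * M (Suc n)" using r(1) by (simp add: less_imp_le)
    finally show ?thesis .
  qed
qed

text \<open>Vertical count inside one cell of level \<open>l\<close>. The values of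
  \<open>a * amp l * tri\<close> vary by at most
  \<open>(1 + C + 3 * \<bar>a\<bar>) * amp (l+1)\<close>: 1 comes from \<open>r\<close>,
  \<open>C\<close> from \<open>w\<close> (the cell has \<open>pos\<close>-width at most
  \<open>rho l\<close>), \<open>3 * \<bar>a\<bar>\<close> from \<open>osc_diff\<close>. In
  \<open>C2\<close> the factor 2 counts the two slopes of the wave and 4 the rounding.\<close>

lemma card_idx_step:
  fixes a C :: real
  defines "C2 \<equiv> 2 * ((1 + C + 3 * \<bar>a\<bar>) / \<bar>a\<bar>) + 4"
  assumes a: "a \<noteq> 0" and C: "0 \<le> C"
    and w: "\<And>n x y. 1 \<le> n \<Longrightarrow> x \<in> {0..1} \<Longrightarrow> y \<in> {0..1} \<Longrightarrow> \<bar>x - y\<bar> \<le> rho n \<Longrightarrow> \<bar>w x - w y\<bar> \<le> C * amp (Suc n)"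
    and S: "S \<subseteq> {0..1}" and G: "\<And>u v. u \<in> S \<Longrightarrow> v \<in> S \<Longrightarrow> \<bar>(w (pos u) + a * osc k u) - (w (pos v) + a * osc k v)\<bar> \<le> r"
    and l: "1 \<le> l" "k \<le> l" and r: "r \<le> amp (Suc l)"
  shows "real (card (idx (Suc l) ` {u \<in> S. idx l u = i})) \<le> C2 * (amp (Suc l) / amp l) * (M (Suc l) / M l)"
proof -
  define th where "th = (1 + C + 3 * \<bar>a\<bar>) / \<bar>a\<bar> * (amp (Suc l) / amp l)"
  define m where "m = real (M (Suc l)) / M l"
  have th0: "0 \<le> th" unfolding th_def using C by (intro mult_nonneg_nonneg divide_nonneg_nonneg) (auto simp: less_imp_le)
  have m0: "0 < m" by (simp add: m_def)
  have Mm: "real (M (Suc l)) = m * M l" by (simp add: m_def)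
  have tri_diff: "\<bar>tri (real (M l) * u) - tri (real (M l) * v)\<bar> \<le> th"
    if uv: "u \<in> S" "v \<in> S" "idx l u = i" "idx l v = i" for u v
  proof -
    have u01: "u \<in> {0..1}" "v \<in> {0..1}" using uv S by auto
    have "\<bar>pos u - pos v\<bar> \<le> rho l"
      using pos_osc[OF u01, of l] pos_osc[OF u01(2,1), of l] uv by simp
    then have "\<bar>w (pos u) - w (pos v)\<bar> \<le> C * amp (Suc l)"
      by (intro w l pos_bounds u01)
    moreover define E where "E = osc k u - osc k v - amp l * (tri (real (M l) * u) - tri (real (M l) * v))"
    have "\<bar>E\<bar> \<le> 3 * amp (Suc l)" unfolding E_def using uv l by (intro osc_diff) simp_all
    then have "\<bar>a * E\<bar> \<le> \<bar>a\<bar> * (3 * amp (Suc l))" unfolding abs_mult by (intro mult_left_mono) auto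
    moreover have "a * (amp l * (tri (real (M l) * u) - tri (real (M l) * v)))
      = ((w (pos u) + a * osc k u) - (w (pos v) + a * osc k v)) - (w (pos u) - w (pos v)) - a * E"
      by (simp add: E_def algebra_simps)
    ultimately have "\<bar>a * (amp l * (tri (real (M l) * u) - tri (real (M l) * v)))\<bar>
       \<le> amp (Suc l) + C * amp (Suc l) + \<bar>a\<bar> * (3 * amp (Suc l))"
      using G[OF uv(1,2)] r by linarith
    moreover have "\<bar>a * (amp l * d)\<bar> = \<bar>a\<bar> * amp l * \<bar>d\<bar>" for d
      by (simp only: abs_mult abs_of_pos amp_pos mult.assoc)
    ultimately have "\<bar>a\<bar> * amp l * \<bar>tri (real (M l) * u) - tri (real (M l) * v)\<bar> \<le> (1 + C + 3 * \<bar>a\<bar>) * amp (Suc l)"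
      by (simp add: distrib_right)
    moreover have "0 < \<bar>a\<bar> * amp l" using a by simp
    ultimately have "\<bar>tri (real (M l) * u) - tri (real (M l) * v)\<bar> \<le> (1 + C + 3 * \<bar>a\<bar>) * amp (Suc l) / (\<bar>a\<bar> * amp l)"
      by (simp only: pos_le_divide_eq mult.commute)
    then show ?thesis by (simp add: th_def)
  qed
  have half: "real (card (idx (Suc l) ` T)) \<le> m * th + 2"
    if T: "T \<subseteq> {u \<in> S. idx l u = i}"
      and inj: "\<And>u v. u \<in> T \<Longrightarrow> v \<in> T \<Longrightarrow> \<bar>real (M l) * u - real (M l) * v\<bar> = \<bar>tri (real (M l) * u) - tri (real (M l) * v)\<bar>"
    for T
  proof -
    \<comment> \<open>One unit is lost in passing from points to indices, another in counting the
      integers of a range.\<close>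
    have "real (card (idx (Suc l) ` T)) \<le> (m * th + 1) + 1"
    proof (rule card_int_set_le)
      show "finite (idx (Suc l) ` T)" using T S by (intro finite_idx) auto
      show "0 \<le> m * th + 1" using th0 m0 by simp
      fix p q assume "p \<in> idx (Suc l) ` T" "q \<in> idx (Suc l) ` T"
      then obtain u v where uv: "u \<in> T" "v \<in> T" "p = idx (Suc l) u" "q = idx (Suc l) v" by blast
      have "\<bar>real (M l) * u - real (M l) * v\<bar> \<le> th"
        unfolding inj[OF uv(1,2)] using uv T by (intro tri_diff) auto
      then have "m * \<bar>real (M l) * u - real (M l) * v\<bar> \<le> m * th" using m0 by (intro mult_left_mono) auto
      then have "\<bar>m * (real (M l) * u - real (M l) * v)\<bar> \<le> m * th" using m0 by (simp add: abs_mult)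
      then have "\<bar>real (M (Suc l)) * u - real (M (Suc l)) * v\<bar> \<le> m * th"
        by (simp add: Mm right_diff_distrib mult.assoc)
      then show "real_of_int (q - p) \<le> m * th + 1"
        using idx_le[of "Suc l" u] idx_le[of "Suc l" v] uv by simp
    qed
    then show ?thesis by simp
  qed
  \<comment> \<open>The rising and the falling half of the wave, on each of which \<open>tri\<close>
    preserves distances.\<close>
  define T1 where "T1 = {u \<in> S. idx l u = i \<and> real (M l) * u \<le> of_int i + 1/2}"
  define T2 where "T2 = {u \<in> S. idx l u = i \<and> of_int i + 1/2 < real (M l) * u}"
  have "real (card (idx (Suc l) ` T1)) \<le> m * th + 2"
  proof (rule half)
    have "tri (real (M l) * u) = real (M l) * u - of_int i" if "u \<in> T1" for u
      using that idx_le(1)[of l u] by (intro tri_left) (auto simp: T1_def)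
    then show "\<bar>real (M l) * u - real (M l) * v\<bar> = \<bar>tri (real (M l) * u) - tri (real (M l) * v)\<bar>"
      if "u \<in> T1" "v \<in> T1" for u v using that by simp
  qed (auto simp: T1_def)
  moreover have "real (card (idx (Suc l) ` T2)) \<le> m * th + 2"
  proof (rule half)
    have "tri (real (M l) * u) = of_int i + 1 - real (M l) * u" if "u \<in> T2" for u
      using that idx_le(2)[of l u] by (intro tri_right) (auto simp: T2_def)
    then show "\<bar>real (M l) * u - real (M l) * v\<bar> = \<bar>tri (real (M l) * u) - tri (real (M l) * v)\<bar>"
      if "u \<in> T2" "v \<in> T2" for u v using that by simp
  qed (auto simp: T2_def)
  moreover have "card (idx (Suc l) ` {u \<in> S. idx l u = i}) \<le> card (idx (Suc l) ` T1) + card (idx (Suc l) ` T2)"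
  proof -
    have "{u \<in> S. idx l u = i} = T1 \<union> T2" by (auto simp: T1_def T2_def)
    then have "idx (Suc l) ` {u \<in> S. idx l u = i} = idx (Suc l) ` T1 \<union> idx (Suc l) ` T2" by (simp only: image_Un)
    then show ?thesis using card_Un_le by metis
  qed
  then have "real (card (idx (Suc l) ` {u \<in> S. idx l u = i})) \<le> real (card (idx (Suc l) ` T1)) + real (card (idx (Suc l) ` T2))"
    by linarith
  ultimately have "real (card (idx (Suc l) ` {u \<in> S. idx l u = i})) \<le> 2 * (m * th) + 4" by linarith
  \<comment> \<open>The additive 4 becomes multiplicative because
    \<open>m * (amp (l+1) / amp l) \<ge> 1\<close>: cell numbers grow faster than amplitudes
    shrink.\<close>
  also have "\<dots> \<le> 2 * (m * th) + 4 * (m * (amp (Suc l) / amp l))"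
  proof -
    have "2 * l + 1 \<le> (l + 3) ^ 3"
    proof -
      have "2 * l + 1 \<le> (l + 3) * 3" by simp
      also have "\<dots> \<le> (l + 3) * (l + 3)\<^sup>2"
        by (intro mult_left_mono) (auto simp: power2_eq_square algebra_simps)
      finally show ?thesis by (simp add: power3_eq_cube power2_eq_square)
    qed
    then have "(2::nat) ^ (2 * l + 1) \<le> 2 ^ ((l + 3) ^ 3)" by (intro power_increasing) auto
    then have "2 ^ (2 * l + 1) * M l \<le> 2 ^ ((l + 3) ^ 3) * M l" by (intro mult_right_mono) auto
    also have "\<dots> \<le> M (Suc l)" by (rule M_growth)
    finally have "real (2 ^ (2 * l + 1) * M l) \<le> real (M (Suc l))" by (simp only: of_nat_le_iff)
    then have "2 ^ (2 * l + 1) \<le> m" by (simp add: m_def pos_le_divide_eq)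
    then have "2 ^ (2 * l + 1) * amp (Suc l) \<le> m * amp (Suc l)" by (intro mult_right_mono) (auto simp: less_imp_le)
    then have "1 \<le> m * amp (Suc l) / amp l" by (simp only: amp_Suc[of l, symmetric] pos_le_divide_eq amp_pos mult_1)
    then have "1 \<le> m * (amp (Suc l) / amp l)" by (simp only: times_divide_eq_right)
    then show ?thesis by linarith
  qed
  also have "\<dots> = C2 * (amp (Suc l) / amp l) * m" by (simp add: C2_def th_def algebra_simps)
  finally show ?thesis unfolding m_def .
qed

text \<open>One application of \<open>card_idx_step\<close> per level; the ratios of amplitudes and
  of cell numbers telescope, and only \<open>C2\<close> accumulates.\<close>

lemma card_idx_iter:
  fixes a C C2 :: real
  defines "C2 \<equiv> 2 * ((1 + C + 3 * \<bar>a\<bar>) / \<bar>a\<bar>) + 4"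
  assumes a: "a \<noteq> 0" and C: "0 \<le> C"
    and w: "\<And>n x y. 1 \<le> n \<Longrightarrow> x \<in> {0..1} \<Longrightarrow> y \<in> {0..1} \<Longrightarrow> \<bar>x - y\<bar> \<le> rho n \<Longrightarrow> \<bar>w x - w y\<bar> \<le> C * amp (Suc n)"
    and S: "S \<subseteq> {0..1}" and G: "\<And>u v. u \<in> S \<Longrightarrow> v \<in> S \<Longrightarrow> \<bar>(w (pos u) + a * osc k u) - (w (pos v) + a * osc k v)\<bar> \<le> r"
    and l: "1 \<le> l" "k \<le> l"
  shows "r \<le> amp (l + j) \<Longrightarrow> real (card (idx (l + j) ` S)) \<le> card (idx l ` S) * C2 ^ j * (amp (l + j) / amp l) * (M (l + j) / M l)"
proof (induction j)
  case 0
  then show ?case using amp_pos[of l] by (simp add: less_imp_neq[symmetric])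
next
  case (Suc j)
  define D where "D = C2 * (amp (Suc (l + j)) / amp (l + j)) * (M (Suc (l + j)) / M (l + j))"
  have C2: "0 \<le> C2" unfolding C2_def using C by simp
  have fin: "finite (idx n ` S)" for n by (rule finite_idx[OF S])
  have "r \<le> amp (l + j)" using Suc.prems amp_antimono[of "l + j" "l + Suc j"] by simp
  note IH = Suc.IH[OF this]
  have "idx (Suc (l + j)) ` S = (\<Union>i\<in>idx (l + j) ` S. idx (Suc (l + j)) ` {u \<in> S. idx (l + j) u = i})"
    by auto
  then have "card (idx (Suc (l + j)) ` S) \<le> (\<Sum>i\<in>idx (l + j) ` S. card (idx (Suc (l + j)) ` {u \<in> S. idx (l + j) u = i}))"
    using card_UN_le[OF fin, of "\<lambda>i. idx (Suc (l + j)) ` {u \<in> S. idx (l + j) u = i}" "l + j"] by simp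
  then have "real (card (idx (Suc (l + j)) ` S)) \<le> real (\<Sum>i\<in>idx (l + j) ` S. card (idx (Suc (l + j)) ` {u \<in> S. idx (l + j) u = i}))"
    by (simp only: of_nat_le_iff)
  also have "\<dots> = (\<Sum>i\<in>idx (l + j) ` S. real (card (idx (Suc (l + j)) ` {u \<in> S. idx (l + j) u = i})))" by simp
  also have "\<dots> \<le> (\<Sum>i\<in>idx (l + j) ` S. D)"
    unfolding D_def C2_def using l Suc.prems
    by (intro sum_mono card_idx_step[OF a C w S G]) simp_all
  also have "\<dots> = card (idx (l + j) ` S) * D" by simp
  also have "\<dots> \<le> (card (idx l ` S) * C2 ^ j * (amp (l + j) / amp l) * (M (l + j) / M l)) * D"
    unfolding D_def using C2 by (intro mult_right_mono[OF IH]) (auto simp: less_imp_le)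
  also have "\<dots> = card (idx l ` S) * C2 ^ Suc j * (amp (l + Suc j) / amp l) * (M (l + Suc j) / M l)"
    unfolding D_def by (simp add: less_imp_neq[symmetric])
  finally show ?case by simp
qed

text \<open>The levels are determined by \<open>rho (n + 1) \<le> r < rho n\<close> and \<open>amp (N + 1) < r \<le> amp N\<close>.\<close>

lemma scale_choice:
  fixes C2 :: real
  assumes C2: "1 \<le> C2" and t: "t < s" and k: "1 \<le> k"
  shows "\<exists>r0>0. \<forall>r. 0 < r \<longrightarrow> r < r0 \<longrightarrow> (\<exists>n N. k \<le> n \<and> Suc n \<le> N \<and> r \<le> amp N \<and>
     (r / gap n + 1 / M (Suc n)) * C2 ^ (N - Suc n) * (amp N / amp (Suc n)) \<le> r powr t)"
proof -
  \<comment> \<open>Half of the slack pays for \<open>1 / amp (n+1)\<close>, the other half for all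
    factors exponential in \<open>N\<close>.\<close>
  define e where "e = (s - t) / 2"
  have e: "e > 0" using t by (simp add: e_def)
  \<comment> \<open>The powers of 2 amount to \<open>2 ^ (3 * N + 3) \<le> 64 ^ N\<close>, as
    \<open>N \<ge> 1\<close>; together with \<open>C2 ^ N\<close> they are at most
    \<open>2 powr (c * N)\<close>.\<close>
  define c where "c = log 2 (64 * C2)"
  \<comment> \<open>The bound \<open>1 / e\<close> serves the estimate of
    \<open>1 / amp (n+1)\<close>; the bound \<open>c / e\<close> gives
    \<open>c * N \<le> e * N^2\<close>.\<close>
  obtain n0 where n0: "k \<le> n0" "1 / e \<le> real n0" "c / e \<le> real n0"
  proof -
    obtain m where m: "max (real k) (max (1 / e) (c / e)) \<le> real m" using real_arch_simple by blast
    show ?thesis by (rule that[of m]) (use m in auto)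
  qed
  have key: "\<exists>n N. k \<le> n \<and> Suc n \<le> N \<and> r \<le> amp N \<and>
     (r / gap n + 1 / M (Suc n)) * C2 ^ (N - Suc n) * (amp N / amp (Suc n)) \<le> r powr t"
    if r: "0 < r" "r < rho n0" for r
  proof -
    have "\<forall>\<^sub>F n in sequentially. rho n < r" using order_tendstoD(2)[OF rho_tendsto r(1)] .
    then obtain n1 where n1: "rho n1 \<le> r" by (auto simp: eventually_sequentially intro: less_imp_le)
    define m where "m = (LEAST n. rho n \<le> r)"
    have m: "rho m \<le> r" unfolding m_def by (rule LeastI[of "\<lambda>n. rho n \<le> r", OF n1])
    have "m > n0"
    proof (rule ccontr)
      assume "\<not> m > n0"
      then have "rho n0 \<le> rho m" by (intro rho_antimono) simp
      with m r show False by simp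
    qed
    then obtain n where n: "m = Suc n" "n0 \<le> n" by (cases m) auto
    have rn: "r < rho n"
    proof (rule ccontr)
      assume "\<not> r < rho n"
      then have "m \<le> n" unfolding m_def by (intro Least_le) simp
      with n show False by simp
    qed
    have n1': "1 \<le> n" using n n0(1) k by simp
    have r_amp: "r \<le> amp (Suc n) ^ Suc n" using rn rho_le_amp[OF n1'] by simp
    also have "\<dots> \<le> amp (Suc n) ^ 1" by (intro power_decreasing amp_le1) (auto simp: less_imp_le)
    finally have r_amp1: "r \<le> amp (Suc n)" by simp
    have "amp \<longlonglongrightarrow> 0"
      using summable_amp[of 0] by (intro summable_LIMSEQ_zero) simp
    then have "\<forall>\<^sub>F n in sequentially. amp n < r" using order_tendstoD(2) r(1) by blast
    then obtain N1 where N1: "amp N1 < r" by (auto simp: eventually_sequentially)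
    define N' where "N' = (LEAST n. amp n < r)"
    have N': "amp N' < r" unfolding N'_def by (rule LeastI[of "\<lambda>n. amp n < r", OF N1])
    have "N' > Suc n"
    proof (rule ccontr)
      assume "\<not> N' > Suc n"
      then have "amp (Suc n) \<le> amp N'" by (intro amp_antimono) simp
      with N' r_amp1 show False by simp
    qed
    then obtain N where N: "N' = Suc N" "Suc n \<le> N" by (cases N') auto
    have rN: "r \<le> amp N"
    proof (rule ccontr)
      assume "\<not> r \<le> amp N"
      then have "N' \<le> N" unfolding N'_def by (intro Least_le) simp
      with N show False by simp
    qed
    have r1: "r \<le> 1" using rN amp_le1[of N] by simp
    \<comment> \<open>The first summand uses \<open>r < rho n\<close>, the second
      \<open>rho (n+1) \<le> r\<close>.\<close>
    have 1: "r / gap n + 1 / M (Suc n) \<le> 2 ^ (N + 2) * r powr (s - 1)"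
    proof -
      have "r powr (2 - s) \<le> rho n * M n"
        unfolding rho_mult_M using s r(1) rn by (intro powr_mono2) auto
      then have "(1/2) ^ Suc n * r powr (2 - s) \<le> gap n"
        unfolding gap_def by (intro mult_left_mono) auto
      then have "r / gap n \<le> r / ((1/2) ^ Suc n * r powr (2 - s))"
        using r(1) by (intro divide_left_mono) auto
      also have "\<dots> = 2 ^ Suc n * (r powr 1 / r powr (2 - s))" using r(1) by (simp add: power_one_over field_simps)
      also have "\<dots> = 2 ^ Suc n * r powr (s - 1)" by (simp only: powr_diff[symmetric]) simp
      also have "\<dots> \<le> 2 ^ (N + 1) * r powr (s - 1)"
        using N by (intro mult_right_mono power_increasing) auto
      finally have "r / gap n \<le> 2 ^ (N + 1) * r powr (s - 1)" .
      moreover have "1 / M (Suc n) \<le> 1 * r powr (s - 1)"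
        using m n s unfolding rho_powr[symmetric] by (simp add: powr_mono2)
      moreover have "1 * r powr (s - 1) \<le> 2 ^ (N + 1) * r powr (s - 1)"
        by (intro mult_right_mono one_le_power) auto
      ultimately show ?thesis by simp
    qed
    have 2: "amp N \<le> 2 ^ (2 * N + 1) * r"
      unfolding amp_Suc[of N] using N' N by simp
    have 3: "1 / amp (Suc n) \<le> r powr (- e)"
    proof -
      have "1 \<le> real (Suc n) * e"
      proof -
        have "1 \<le> real n0 * e" using n0(2) e by (simp add: pos_divide_le_eq)
        also have "\<dots> \<le> real (Suc n) * e" using n(2) e by (intro mult_right_mono) auto
        finally show ?thesis .
      qed
      have "r powr e \<le> (amp (Suc n) ^ Suc n) powr e"
        using r_amp r(1) e by (intro powr_mono2) auto
      also have "\<dots> = amp (Suc n) powr (real (Suc n) * e)"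
        by (simp only: powr_powr[symmetric] powr_realpow[OF amp_pos])
      also have "\<dots> \<le> amp (Suc n) powr 1"
        using \<open>1 \<le> real (Suc n) * e\<close> amp_le1 by (intro powr_mono') (auto simp: less_imp_le)
      finally have "r powr e \<le> amp (Suc n)" by (simp add: less_imp_le)
      then have "1 / amp (Suc n) \<le> 1 / r powr e" using r(1) by (intro divide_left_mono) auto
      then show ?thesis by (simp add: powr_minus_divide)
    qed
    \<comment> \<open>A factor exponential in \<open>N\<close> is compared with
      \<open>amp N powr (- e) = 2 powr (e * N^2)\<close>.\<close>
    have 4: "2 ^ (N + 2) * C2 ^ (N - Suc n) * 2 ^ (2 * N + 1) \<le> r powr (- e)"
    proof -
      have "2 ^ (N + 2) * C2 ^ (N - Suc n) * 2 ^ (2 * N + 1) \<le> (2 ^ (N + 2) * 2 ^ (2 * N + 1)) * C2 ^ N"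
        using C2 by (simp add: power_increasing mult.assoc mult.left_commute)
      also have "(2::real) ^ (N + 2) * 2 ^ (2 * N + 1) = 2 ^ (3 * N + 3)"
        unfolding power_add[symmetric] by (rule arg_cong[where f = "power 2"]) simp
      also have "\<dots> \<le> 2 ^ (6 * N)" using N by (intro power_increasing) auto
      also have "(2::real) ^ (6 * N) = 64 ^ N" by (simp add: power_mult)
      finally have "2 ^ (N + 2) * C2 ^ (N - Suc n) * 2 ^ (2 * N + 1) \<le> 64 ^ N * C2 ^ N"
        using C2 by simp
      also have "\<dots> = (64 * C2) powr N" using C2 by (simp add: powr_realpow power_mult_distrib)
      also have "\<dots> = 2 powr (c * N)" using C2 by (simp add: c_def powr_powr[symmetric])
      also have "\<dots> \<le> 2 powr (e * N\<^sup>2)"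
      proof (rule powr_mono)
        have "c \<le> e * real n0" using n0(3) e by (simp add: pos_divide_le_eq mult.commute)
        also have "\<dots> \<le> e * real N" using n N e by (intro mult_left_mono) auto
        finally have "c * N \<le> e * real N * real N" by (intro mult_right_mono) auto
        then show "c * N \<le> e * real (N\<^sup>2)" by (simp add: power2_eq_square mult.assoc)
      qed simp
      also have "\<dots> = amp N powr (- e)"
        by (simp add: amp_def powr_realpow[symmetric] powr_powr powr_minus_divide powr_divide mult.commute)
      also have "\<dots> \<le> r powr (- e)" using rN r(1) e by (intro powr_mono2') auto
      finally show ?thesis .
    qed
    have "(r / gap n + 1 / M (Suc n)) * C2 ^ (N - Suc n) * (amp N / amp (Suc n))
       = ((r / gap n + 1 / M (Suc n)) * C2 ^ (N - Suc n) * amp N) * (1 / amp (Suc n))" by simp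
    also have "\<dots> \<le> ((2 ^ (N + 2) * r powr (s - 1)) * C2 ^ (N - Suc n) * (2 ^ (2 * N + 1) * r)) * r powr (- e)"
      using 1 2 3 C2 r(1) by (intro mult_mono mult_nonneg_nonneg add_nonneg_nonneg) (auto simp: less_imp_le)
    also have "\<dots> = (2 ^ (N + 2) * C2 ^ (N - Suc n) * 2 ^ (2 * N + 1)) * (r powr (s - 1) * r powr 1 * r powr (- e))"
      using r(1) by (simp add: algebra_simps)
    also have "\<dots> \<le> r powr (- e) * (r powr (s - 1) * r powr 1 * r powr (- e))"
      using 4 by (intro mult_right_mono) auto
    also have "\<dots> = r powr (- e + (s - 1 + 1 + - e))" by (simp only: powr_add)
    also have "- e + (s - 1 + 1 + - e) = t" by (simp add: e_def field_simps)
    finally have "(r / gap n + 1 / M (Suc n)) * C2 ^ (N - Suc n) * (amp N / amp (Suc n)) \<le> r powr t" .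
    moreover have "k \<le> n" using n0(1) n(2) by simp
    ultimately show ?thesis using N(2) rN by blast
  qed
  show ?thesis by (rule exI[of _ "rho n0"]) (use key in simp)
qed

text \<open>Mass distribution with the Lebesgue measure of the parameter \<open>u\<close>: a set of
  diameter \<open>r\<close> catches parameters of measure at most \<open>r powr t\<close> along
  \<open>u \<mapsto> (pos u, F (pos u))\<close>, so every fine cover costs at least
  \<open>q - p\<close>.\<close>

lemma not_hnull_graph:
  assumes a: "a \<noteq> 0" and C: "0 \<le> C"
    and w: "\<And>n x y. 1 \<le> n \<Longrightarrow> x \<in> {0..1} \<Longrightarrow> y \<in> {0..1} \<Longrightarrow> \<bar>x - y\<bar> \<le> rho n \<Longrightarrow> \<bar>w x - w y\<bar> \<le> C * amp (Suc n)"
    and k: "1 \<le> k" and cell: "{p..q} \<subseteq> {0..1}" "p < q"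
    and F: "\<And>u. u \<in> {p..q} \<Longrightarrow> F (pos u) = w (pos u) + a * osc k u"
    and t: "0 \<le> t" "t < s"
  shows "\<not> hnull t (graph01 F)"
proof
  assume null: "hnull t (graph01 F)"
  define C2 where "C2 = 2 * ((1 + C + 3 * \<bar>a\<bar>) / \<bar>a\<bar>) + 4"
  have C2: "1 \<le> C2" unfolding C2_def using C by simp
  obtain r0 where r0: "r0 > 0" "\<And>r. 0 < r \<Longrightarrow> r < r0 \<Longrightarrow> \<exists>n N. k \<le> n \<and> Suc n \<le> N \<and> r \<le> amp N \<and>
     (r / gap n + 1 / M (Suc n)) * C2 ^ (N - Suc n) * (amp N / amp (Suc n)) \<le> r powr t"
    using scale_choice[OF C2 t(2) k] by blast
  \<comment> \<open>\<open>r0 / 2\<close> keeps the diameters strictly below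
    \<open>r0\<close>.\<close>
  have "r0 / 2 > 0" "q - p > 0" using r0 cell by auto
  from null[unfolded hnull_def, rule_format, OF this]
  obtain U where U: "\<And>i. bounded (U i)" "\<And>i. diameter (U i) \<le> r0 / 2" "graph01 F \<subseteq> (\<Union>i. U i)"
     "(\<Sum>i. ennreal (diameter (U i) powr t)) < ennreal (q - p)" by blast
  define S where "S i = {u \<in> {p..q}. (pos u, F (pos u)) \<in> U i}" for i
  have cover: "{p..q} \<subseteq> (\<Union>i. S i)"
  proof
    fix u assume u: "u \<in> {p..q}"
    then have "u \<in> {0..1}" using cell by blast
    then have "(pos u, F (pos u)) \<in> graph01 F" unfolding graph01_def using pos_bounds by blast
    then obtain i where "(pos u, F (pos u)) \<in> U i" using U(3) by blast
    then show "u \<in> (\<Union>i. S i)" using u by (auto simp: S_def)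
  qed
  \<comment> \<open>\<open>U i\<close> is arbitrary and \<open>S i\<close> need not be measurable,
    so it is enclosed in a Borel set.\<close>
  have "\<exists>T\<in>sets lborel. S i \<subseteq> T \<and> emeasure lborel T \<le> ennreal (diameter (U i) powr t)" for i
  proof -
    let ?r = "diameter (U i)"
    have S01: "S i \<subseteq> {0..1}" using cell by (auto simp: S_def)
    have "dist (pos u, F (pos u)) (pos v, F (pos v)) \<le> ?r" if "u \<in> S i" "v \<in> S i" for u v
      using that by (intro diameter_bounded_bound U) (auto simp: S_def)
    then have d: "\<bar>pos u - pos v\<bar> \<le> ?r" "\<bar>F (pos u) - F (pos v)\<bar> \<le> ?r" if "u \<in> S i" "v \<in> S i" for u v
      using that dist_fst_le[of "(pos u, F (pos u))" "(pos v, F (pos v))"]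
        dist_snd_le[of "(pos u, F (pos u))" "(pos v, F (pos v))"]
      by (force simp: dist_real_def)+
    have G: "\<bar>(w (pos u) + a * osc k u) - (w (pos v) + a * osc k v)\<bar> \<le> ?r" if "u \<in> S i" "v \<in> S i" for u v
      using d(2)[OF that] F[of u] F[of v] that by (simp add: S_def)
    have r: "0 \<le> ?r" by (rule diameter_ge_0[OF U(1)])
    show ?thesis
    \<comment> \<open>\<open>scale_choice\<close> needs a positive diameter; a set of diameter 0
      catches at most one parameter because \<open>pos\<close> is injective.\<close>
    proof (cases "?r = 0")
      case True
      have "u = v" if uv: "u \<in> S i" "v \<in> S i" for u v
      proof -
        have "pos u = pos v" using d(1)[OF uv] True by simp
        then show ?thesis using pos_strict_mono[of u v] pos_strict_mono[of v u] uv S01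
          by (metis linorder_less_linear less_irrefl subsetD)
      qed
      then have "finite (S i)" by (metis finite.simps finite_subset subsetI singletonI)
      then show ?thesis
        by (intro bexI[of _ "S i"]) (auto simp: finite_imp_null_set_lborel null_setsD1 null_setsD2[OF finite_imp_null_set_lborel, simplified])
    next
      case False
      then have r': "0 < ?r" "?r < r0" using r U(2)[of i] r0(1) by linarith+
      from r0(2)[OF this] obtain n N where nN: "k \<le> n" "Suc n \<le> N" "?r \<le> amp N"
        "(?r / gap n + 1 / M (Suc n)) * C2 ^ (N - Suc n) * (amp N / amp (Suc n)) \<le> ?r powr t" by blast
      \<comment> \<open>The closed cells of level \<open>N\<close> met by \<open>S i\<close>, each
        of measure \<open>1 / M N\<close>.\<close>
      define T where "T = (\<Union>j\<in>idx N ` S i. {real_of_int j / M N..(real_of_int j + 1) / M N})"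
      have "S i \<subseteq> T"
      proof
        fix u assume u: "u \<in> S i"
        then have "u \<in> {real_of_int (idx N u) / M N..(real_of_int (idx N u) + 1) / M N}"
          using idx_le[of N u] by (simp add: pos_le_divide_eq pos_divide_le_eq mult.commute)
        then show "u \<in> T" unfolding T_def using u by blast
      qed
      moreover have "T \<in> sets lborel"
        unfolding T_def by (intro sets.finite_UN finite_idx S01) auto
      moreover have "emeasure lborel T \<le> ennreal (?r powr t)"
      proof -
        have "emeasure lborel T \<le> (\<Sum>j\<in>idx N ` S i. emeasure lborel {real_of_int j / M N..(real_of_int j + 1) / M N})"
          unfolding T_def by (intro emeasure_subadditive_finite finite_idx S01) auto
        also have "\<dots> = (\<Sum>j\<in>idx N ` S i. ennreal (1 / M N))"
        proof (rule sum.cong[OF refl])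
          fix j :: int
          have "real_of_int j / M N \<le> (real_of_int j + 1) / M N" by (simp add: divide_right_mono)
          then show "emeasure lborel {real_of_int j / M N..(real_of_int j + 1) / M N} = ennreal (1 / M N)"
            by (simp add: diff_divide_distrib[symmetric])
        qed
        also have "\<dots> = ennreal (card (idx N ` S i) * (1 / M N))"
          by (simp add: ennreal_of_nat_eq_real_of_nat ennreal_mult[symmetric])
        also have "\<dots> \<le> ennreal (?r powr t)"
        proof (rule ennreal_leI)
          have "real (card (idx N ` S i)) \<le> card (idx (Suc n) ` S i) * C2 ^ (N - Suc n) * (amp N / amp (Suc n)) * (M N / M (Suc n))"
            using card_idx_iter[OF a C w S01 G, of "Suc n" "N - Suc n"] nN by (simp add: C2_def)
          also have "\<dots> \<le> (?r / gap n * M (Suc n) + 1) * C2 ^ (N - Suc n) * (amp N / amp (Suc n)) * (M N / M (Suc n))"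
            using C2 d(1) r by (intro mult_right_mono card_idx_pos S01) (auto simp: less_imp_le)
          finally have "real (card (idx N ` S i)) * (1 / M N) \<le>
            (?r / gap n * M (Suc n) + 1) * C2 ^ (N - Suc n) * (amp N / amp (Suc n)) * (M N / M (Suc n)) * (1 / M N)"
            by (intro mult_right_mono) auto
          also have "\<dots> = ((?r / gap n * M (Suc n) + 1) / M (Suc n)) * C2 ^ (N - Suc n) * (amp N / amp (Suc n))"
            by simp
          also have "(?r / gap n * M (Suc n) + 1) / M (Suc n) = ?r / gap n + 1 / M (Suc n)"
            by (simp add: add_divide_distrib)
          also note nN(4)
          finally show "real (card (idx N ` S i)) * (1 / M N) \<le> ?r powr t" .
        qed
        finally show ?thesis .
      qed
      ultimately show ?thesis by blast
    qed
  qed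
  then obtain T where T: "\<And>i. T i \<in> sets lborel" "\<And>i. S i \<subseteq> T i"
     "\<And>i. emeasure lborel (T i) \<le> ennreal (diameter (U i) powr t)" by metis
  have "ennreal (q - p) = emeasure lborel {p..q}" using cell by simp
  also have "\<dots> \<le> emeasure lborel (\<Union>i. T i)"
    using cover T(1,2) by (intro emeasure_mono sets.countable_UN) blast+
  also have "\<dots> \<le> (\<Sum>i. emeasure lborel (T i))"
    using T(1) by (intro emeasure_subadditive_countably) auto
  also have "\<dots> \<le> (\<Sum>i. ennreal (diameter (U i) powr t))"
    using T(3) by (intro suminf_le) auto
  also have "\<dots> < ennreal (q - p)" by (rule U(4))
  finally show False by simp
qed

end

subsection \<open>The closed subspace\<close>

text \<open>Vandermonde nonsingularity: vanishing moments annihilate every polynomial, in particular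
  the one whose roots are exactly \<open>T - {t}\<close>.\<close>

lemma power_sums_eq_0_imp:
  fixes c :: "real \<Rightarrow> real"
  assumes T: "finite T" "t \<in> T" and zero: "\<And>i. (\<Sum>u\<in>T. c u * u ^ i) = 0"
  shows "c t = 0"
proof -
  define p where "p = (\<Prod>v\<in>T - {t}. [:- v, 1:])"
  have "(\<Sum>u\<in>T. c u * poly p u) = (\<Sum>u\<in>T. \<Sum>i\<le>degree p. coeff p i * (c u * u ^ i))"
    by (simp add: poly_altdef sum_distrib_left mult_ac)
  also have "\<dots> = (\<Sum>i\<le>degree p. coeff p i * (\<Sum>u\<in>T. c u * u ^ i))"
    by (subst sum.swap) (simp add: sum_distrib_left)
  also have "\<dots> = 0" by (simp add: zero)
  finally have "(\<Sum>u\<in>T. c u * poly p u) = 0" .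
  moreover have "(\<Sum>u\<in>T. c u * poly p u) = (\<Sum>u\<in>{t}. c u * poly p u)"
    using T by (intro sum.mono_neutral_right) (auto simp: p_def poly_prod)
  moreover have "poly p t \<noteq> 0" using T(1) by (auto simp: p_def poly_prod)
  ultimately show ?thesis by simp
qed

context cantor_scale
begin

section \<open>Disjoint bumps and the space they generate\<close>

text \<open>These intervals are disjoint for different \<open>i\<close>, since
  \<open>2 * M (i+1) < M (i+2)\<close>, and accumulate at 0. The shift to level \<open>i+1\<close>
  matches the modulus estimates, which start at level 1.\<close>

definition cell :: "nat \<Rightarrow> real set" where
  "cell i = {1 / M (Suc i)..2 / M (Suc i)}"

text \<open>Clamping the argument extends \<open>osc\<close> continuously by 0, as
  \<open>osc (i+1)\<close> vanishes at both endpoints of the cell.\<close>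

definition bump :: "nat \<Rightarrow> real \<Rightarrow> real" where
  "bump i u = osc (Suc i) (max (1 / M (Suc i)) (min (2 / M (Suc i)) u))"

definition mid :: "nat \<Rightarrow> real" where
  "mid i = (3/2) / M (Suc i)"

lemma two_le_M: "2 \<le> real (M (Suc i))"
  using M_Suc_gt[of i] M_ge1[of i] by linarith

lemma cell_subset: "cell i \<subseteq> {0..1}"
  using two_le_M[of i] by (auto simp: cell_def intro: order_trans)

lemma mid_cell: "mid i \<in> cell i"
  using two_le_M[of i] by (auto simp: mid_def cell_def field_simps)

lemma bump_cell: "u \<in> cell i \<Longrightarrow> bump i u = osc (Suc i) u"
  by (simp add: bump_def cell_def max_absorb2 min_absorb2)

lemma bump_eq_0:
  assumes "u \<le> 1 / M (Suc i) \<or> 2 / M (Suc i) \<le> u" shows "bump i u = 0"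
proof -
  have "1 / real (M (Suc i)) \<le> 2 / real (M (Suc i))" by (simp add: divide_right_mono)
  then have "max (1 / M (Suc i)) (min (2 / M (Suc i)) u) \<in> {1 / real (M (Suc i)), 2 / real (M (Suc i))}"
    using assms by (auto simp: max_def min_def)
  then have "real (M (Suc i)) * max (1 / M (Suc i)) (min (2 / M (Suc i)) u) \<in> \<int>" by auto
  then show ?thesis unfolding bump_def by (rule osc_eq_0)
qed

lemma bump_outside: "u \<notin> cell i \<Longrightarrow> bump i u = 0"
  by (rule bump_eq_0) (auto simp: cell_def)

lemma bump_other_cell:
  assumes "u \<in> cell i" "j \<noteq> i" shows "bump j u = 0"
proof (rule bump_eq_0)
  have le: "2 / real (M (Suc n)) \<le> 1 / real (M (Suc m))" if "m < n" for m n
  proof -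
    have "2 * M (Suc m) < M (Suc (Suc m))" by (rule M_Suc_gt)
    also have "\<dots> \<le> M (Suc n)" using that by (intro M_le) simp
    finally have "real (2 * M (Suc m)) \<le> real (M (Suc n))" by (simp only: of_nat_le_iff)
    then show ?thesis by (simp add: field_simps)
  qed
  from assms(2) consider "i < j" | "j < i" by linarith
  then show "u \<le> 1 / M (Suc j) \<or> 2 / M (Suc j) \<le> u"
  proof cases
    case 1
    then show ?thesis using le[of i j] assms(1) by (auto simp: cell_def)
  next
    case 2
    then show ?thesis using le[of j i] assms(1) by (auto simp: cell_def)
  qed
qed

lemma bump_mid_pos: "0 < bump i (mid i)"
proof -
  have "real (M (Suc i)) * mid i = 3/2" by (simp add: mid_def)
  moreover have "tri (3/2) = 3/2 - real_of_int 1" by (rule tri_left) auto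
  ultimately have "tri (real (M (Suc i)) * mid i) = 1/2" by (simp only:)
  then have "0 < amp (Suc i) * tri (real (M (Suc i)) * mid i)" by simp
  also have "\<dots> \<le> bump i (mid i)" using osc_ge_term by (simp add: bump_cell[OF mid_cell])
  finally show ?thesis .
qed

lemma bump_bounds: "0 \<le> bump i u" "bump i u \<le> 2 * (1/2) ^ i"
proof -
  show "0 \<le> bump i u" by (simp add: bump_def osc_nonneg)
  have "bump i u \<le> 2 * amp (Suc i)" by (simp add: bump_def osc_le)
  also have "amp (Suc i) \<le> (1/2) ^ i"
    unfolding amp_def by (intro power_decreasing) (auto simp: power2_eq_square)
  finally show "bump i u \<le> 2 * (1/2) ^ i" by simp
qed

lemma bump_continuous: "continuous_on A (bump i)"
  unfolding bump_def by (intro continuous_on_compose2[OF osc_continuous] continuous_intros) auto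

text \<open>The functions that, over each cell, are a multiple of the bump composed with
  \<open>Phi\<close>. Proportionality is cross-multiplied: the conditions are linear, mention no
  coefficients and survive pointwise limits, so closedness is immediate.\<close>

definition V0 :: "(real \<Rightarrow> real) set" where
  "V0 = {F \<in> C01. (\<forall>x\<in>{0..1}. (\<forall>i. Phi x \<notin> cell i) \<longrightarrow> F x = 0) \<and>
     (\<forall>i. \<forall>x\<in>{0..1}. \<forall>y\<in>{0..1}. Phi x \<in> cell i \<longrightarrow> Phi y \<in> cell i \<longrightarrow>
        F x * bump i (Phi y) = F y * bump i (Phi x))}"

lemma V0_subset: "V0 \<subseteq> C01"
  by (auto simp: V0_def)

lemma V0_subspace: "fs.subspace V0"
proof (rule fs.subspaceI)
  show "0 \<in> V0" using fs.subspace_0[OF subspace_C01] by (simp add: V0_def)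
  show "f + g \<in> V0" if "f \<in> V0" "g \<in> V0" for f g
    using that fs.subspace_add[OF subspace_C01] by (simp add: V0_def distrib_right)
  show "fscale c f \<in> V0" if "f \<in> V0" for c f
    using that fs.subspace_scale[OF subspace_C01] by (simp add: V0_def mult.assoc)
qed

lemma V0_closed: "closed_C01 V0"
  unfolding closed_C01_def
proof (intro allI impI, elim conjE)
  fix g f assume g: "\<forall>n. g n \<in> V0" and f: "f \<in> C01" and lim: "uniform_limit {0..1} g f sequentially"
  have pt: "(\<lambda>n. g n x) \<longlonglongrightarrow> f x" if "x \<in> {0..1}" for x
    using tendsto_uniform_limitI[OF lim that] .
  show "f \<in> V0"
    unfolding V0_def
  proof (intro CollectI conjI ballI allI impI f)
    fix x assume x: "x \<in> {0..1}" "\<forall>i. Phi x \<notin> cell i"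
    then have "g n x = 0" for n using g by (simp add: V0_def)
    then show "f x = 0" using pt[OF x(1)] by (simp add: LIMSEQ_const_iff)
  next
    fix i x y assume xy: "x \<in> {0..1}" "y \<in> {0..1}" "Phi x \<in> cell i" "Phi y \<in> cell i"
    have "(\<lambda>n. g n x * bump i (Phi y)) \<longlonglongrightarrow> f x * bump i (Phi y)"
      by (intro tendsto_mult pt xy tendsto_const)
    moreover have "(\<lambda>n. g n x * bump i (Phi y)) = (\<lambda>n. g n y * bump i (Phi x))"
      using g xy by (auto simp: V0_def)
    moreover have "(\<lambda>n. g n y * bump i (Phi x)) \<longlonglongrightarrow> f y * bump i (Phi x)"
      by (intro tendsto_mult pt xy tendsto_const)
    ultimately show "f x * bump i (Phi y) = f y * bump i (Phi x)" by (metis LIMSEQ_unique)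
  qed
qed

text \<open>The coefficient is read off at \<open>pos (mid i)\<close>, which \<open>Phi\<close>
  sends to \<open>mid i\<close>, where the bump is positive.\<close>

lemma V0_rep:
  assumes "F \<in> V0"
  obtains a where "\<And>x i. x \<in> {0..1} \<Longrightarrow> Phi x \<in> cell i \<Longrightarrow> F x = a i * bump i (Phi x)"
proof -
  have "F x = F (pos (mid i)) / bump i (mid i) * bump i (Phi x)" if "x \<in> {0..1}" "Phi x \<in> cell i" for x i
  proof -
    have m: "mid i \<in> {0..1}" using mid_cell cell_subset by blast
    have "F x * bump i (Phi (pos (mid i))) = F (pos (mid i)) * bump i (Phi x)"
      using assms that pos_bounds[OF m] mid_cell[of i] by (simp add: V0_def Phi_pos[OF m])
    then show ?thesis using bump_mid_pos[of i] by (simp add: Phi_pos[OF m] field_simps)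
  qed
  then show ?thesis by (rule that)
qed

lemma V0_const:
  assumes "F \<in> V0" "x \<in> {0..1}" "y \<in> {0..1}" "Phi x = Phi y"
  shows "F x = F y"
proof (cases "\<exists>i. Phi x \<in> cell i")
  case True
  obtain a where "\<And>x i. x \<in> {0..1} \<Longrightarrow> Phi x \<in> cell i \<Longrightarrow> F x = a i * bump i (Phi x)"
    using V0_rep[OF assms(1)] by blast
  with True assms show ?thesis by metis
next
  case False
  then show ?thesis using assms by (simp add: V0_def)
qed

text \<open>Elements of \<open>V0\<close> with coefficients \<open>c ^ i\<close>; for
  \<open>0 < c < 1\<close> they form an independent family of continuum size.\<close>

definition geo :: "real \<Rightarrow> real \<Rightarrow> real" where
  "geo c x = (if x \<in> {0..1} then \<Sum>i. c ^ i * bump i (Phi x) else 0)"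

lemma geo_cell:
  assumes "x \<in> {0..1}" "Phi x \<in> cell i" shows "geo c x = c ^ i * bump i (Phi x)"
proof -
  have "(\<Sum>i. c ^ i * bump i (Phi x)) = (\<Sum>i\<in>{i}. c ^ i * bump i (Phi x))"
    using bump_other_cell[OF assms(2)] by (intro suminf_finite) auto
  then show ?thesis using assms(1) by (simp add: geo_def)
qed

lemma geo_V0:
  assumes "c \<in> {0<..<1}" shows "geo c \<in> V0"
proof -
  have "uniform_limit UNIV (\<lambda>n u. \<Sum>i<n. c ^ i * bump i u) (\<lambda>u. \<Sum>i. c ^ i * bump i u) sequentially"
  proof (rule Weierstrass_m_test)
    show "summable (\<lambda>i. 2 * (1/2::real) ^ i)" by (intro summable_mult summable_geometric) auto
    show "norm (c ^ i * bump i u) \<le> 2 * (1/2) ^ i" for i u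
    proof -
      have "norm (c ^ i * bump i u) \<le> 1 * bump i u"
        unfolding real_norm_def abs_mult using assms bump_bounds(1)[of i u]
        by (intro mult_mono) (auto simp: power_le_one)
      then show ?thesis using bump_bounds(2)[of i u] by simp
    qed
  qed
  then have "continuous_on UNIV (\<lambda>u. \<Sum>i. c ^ i * bump i u)"
    by (rule uniform_limit_theorem[rotated])
       (auto intro!: always_eventually continuous_intros bump_continuous)
  then have "continuous_on {0..1} (\<lambda>x. \<Sum>i. c ^ i * bump i (Phi x))"
    by (rule continuous_on_compose2[OF _ Phi_continuous]) auto
  then have "continuous_on {0..1} (geo c)"
    by (rule continuous_on_eq) (simp add: geo_def)
  then have "geo c \<in> C01" by (simp add: C01_def geo_def)
  moreover have "geo c x = 0" if "x \<in> {0..1}" "\<forall>i. Phi x \<notin> cell i" for x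
    using that by (simp add: geo_def bump_outside)
  moreover have "geo c x * bump i (Phi y) = geo c y * bump i (Phi x)"
    if "x \<in> {0..1}" "y \<in> {0..1}" "Phi x \<in> cell i" "Phi y \<in> cell i" for x y i
    using that by (simp add: geo_cell)
  ultimately show ?thesis by (simp add: V0_def)
qed

lemma geo_independent:
  assumes T: "finite T" "t \<in> T" and zero: "(\<Sum>t\<in>T. fscale (c t) (geo t)) = 0"
  shows "c t = 0"
proof (rule power_sums_eq_0_imp[OF T])
  fix i
  have m: "mid i \<in> {0..1}" using mid_cell cell_subset by blast
  have "(\<Sum>t\<in>T. fscale (c t) (geo t)) (pos (mid i)) = (\<Sum>t\<in>T. c t * geo t (pos (mid i)))"
    by (induction T rule: infinite_finite_induct) auto
  also have "\<dots> = (\<Sum>t\<in>T. c t * (t ^ i * bump i (mid i)))"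
    using geo_cell[OF pos_bounds[OF m], of i] mid_cell[of i] by (simp add: Phi_pos[OF m])
  also have "\<dots> = (\<Sum>t\<in>T. c t * t ^ i) * bump i (mid i)"
    by (simp add: sum_distrib_right mult.assoc)
  finally have "(\<Sum>t\<in>T. c t * t ^ i) * bump i (mid i) = 0" by (simp add: zero)
  then show "(\<Sum>t\<in>T. c t * t ^ i) = 0" using bump_mid_pos[of i] by simp
qed

text \<open>Taking linear combinations changes only the constant \<open>C\<close>. It enters the
  lower bound through \<open>C2\<close>, so the same scales serve the whole span.\<close>

lemma span_modulus:
  assumes B: "\<And>f n x y. f \<in> B \<Longrightarrow> 1 \<le> n \<Longrightarrow> x \<in> {0..1} \<Longrightarrow> y \<in> {0..1} \<Longrightarrow> \<bar>x - y\<bar> \<le> 1 / M n \<Longrightarrow> \<bar>f x - f y\<bar> \<le> (1/2) ^ (Suc n)\<^sup>2"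
    and w: "w \<in> fs.span B"
  shows "\<exists>C\<ge>0. \<forall>n x y. 1 \<le> n \<longrightarrow> x \<in> {0..1} \<longrightarrow> y \<in> {0..1} \<longrightarrow> \<bar>x - y\<bar> \<le> rho n \<longrightarrow> \<bar>w x - w y\<bar> \<le> C * amp (Suc n)"
  using w
proof (induction rule: fs.span_induct_alt)
  case base
  show ?case by (intro exI[of _ 0]) auto
next
  case (step c f g)
  then obtain C where C: "C \<ge> 0" "\<And>n x y. 1 \<le> n \<Longrightarrow> x \<in> {0..1} \<Longrightarrow> y \<in> {0..1} \<Longrightarrow> \<bar>x - y\<bar> \<le> rho n \<Longrightarrow> \<bar>g x - g y\<bar> \<le> C * amp (Suc n)"
    by blast
  show ?case
  proof (intro exI[of _ "\<bar>c\<bar> + C"] conjI allI impI)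
    fix n x y assume h: "1 \<le> n" "x \<in> {0..1::real}" "y \<in> {0..1::real}" "\<bar>x - y\<bar> \<le> rho n"
    then have "\<bar>x - y\<bar> \<le> 1 / M n" using rho_le_inverse[of n] by simp
    from B[OF step(1) h(1,2,3) this] have "\<bar>f x - f y\<bar> \<le> amp (Suc n)" by (simp only: amp_def)
    then have "\<bar>c * (f x - f y)\<bar> \<le> \<bar>c\<bar> * amp (Suc n)" unfolding abs_mult by (intro mult_left_mono) auto
    moreover have "\<bar>g x - g y\<bar> \<le> C * amp (Suc n)" by (rule C(2)[OF h])
    moreover have "(fscale c f + g) x - (fscale c f + g) y = c * (f x - f y) + (g x - g y)"
      by (simp add: algebra_simps)
    ultimately show "\<bar>(fscale c f + g) x - (fscale c f + g) y\<bar> \<le> (\<bar>c\<bar> + C) * amp (Suc n)"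
      unfolding distrib_right by linarith
  qed (use C in simp)
qed

lemma spaceable_extension:
  assumes B: "finite B" "B \<subseteq> C01" "fs.span B \<subseteq> H_s s \<union> {0}"
    and modulus: "\<And>f n x y. f \<in> B \<Longrightarrow> 1 \<le> n \<Longrightarrow> x \<in> {0..1} \<Longrightarrow> y \<in> {0..1} \<Longrightarrow> \<bar>x - y\<bar> \<le> 1 / M n \<Longrightarrow> \<bar>f x - f y\<bar> \<le> (1/2) ^ (Suc n)\<^sup>2"
  shows "\<exists>V. lin_subspace V \<and> closed_C01 V \<and> has_dim V (UNIV :: real set) \<and> fs.span B \<subseteq> V \<and> V \<subseteq> H_s s \<union> {0}"
proof -
  define V where "V = fs.span (B \<union> V0)"
  have span_V0: "fs.span V0 = V0" using V0_subspace by (rule fs.span_eq_iff[THEN iffD2])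
  have "V \<subseteq> C01" unfolding V_def using B(2) V0_subset by (intro span_subset_C01) auto
  then have V: "lin_subspace V" by (simp add: lin_subspace_def V_def)
  moreover have "closed_C01 V"
    unfolding V_def using B V0_subset V0_closed by (intro closed_C01_span_Un) (simp_all add: span_V0)
  moreover have "has_dim V (UNIV :: real set)"
  proof (rule has_dim_continuumI[OF V])
    show "geo t \<in> V" if "t \<in> {0<..<1}" for t
      using geo_V0[OF that] fs.span_superset[of "B \<union> V0"] by (auto simp: V_def)
  qed (rule geo_independent)
  moreover have "fs.span B \<subseteq> V" unfolding V_def by (intro fs.span_mono) auto
  moreover have "V \<subseteq> H_s s \<union> {0}"
  proof
    fix f assume "f \<in> V"
    then obtain w F where wF: "w \<in> fs.span B" "F \<in> V0" "f = w + F"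
      unfolding V_def fs.span_Un span_V0 by blast
    have wC: "w \<in> C01" using span_subset_C01[OF B(2)] wF(1) by blast
    have FC: "F \<in> C01" using wF(2) V0_subset by blast
    obtain a where a: "\<And>x i. x \<in> {0..1} \<Longrightarrow> Phi x \<in> cell i \<Longrightarrow> F x = a i * bump i (Phi x)"
      using V0_rep[OF wF(2)] by blast
    show "f \<in> H_s s \<union> {0}"
    \<comment> \<open>If all coefficients vanish, then \<open>F = 0\<close> and \<open>f\<close> is
      in the span of \<open>B\<close>; otherwise one nonzero coefficient suffices for the lower
      bound, taken over its cell.\<close>
    proof (cases "\<exists>i. a i \<noteq> 0")
      case False
      have "F = 0"
      proof
        fix x show "F x = 0 x"
        proof (cases "x \<in> {0..1}")
          case True
          then show ?thesis using wF(2) a[OF True] False by (cases "\<exists>i. Phi x \<in> cell i") (auto simp: V0_def)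
        next
          case False
          then show ?thesis using FC unfolding C01_def zero_fun_def by blast
        qed
      qed
      then show ?thesis using wF B(3) by auto
    next
      case True
      then obtain i where i: "a i \<noteq> 0" by blast
      have "\<exists>C\<ge>0. \<forall>n x y. 1 \<le> n \<longrightarrow> x \<in> {0..1} \<longrightarrow> y \<in> {0..1} \<longrightarrow> \<bar>x - y\<bar> \<le> rho n \<longrightarrow> \<bar>w x - w y\<bar> \<le> C * amp (Suc n)"
        by (rule span_modulus[OF _ wF(1)]) (rule modulus)
      then obtain C where C: "C \<ge> 0" "\<And>n x y. 1 \<le> n \<Longrightarrow> x \<in> {0..1} \<Longrightarrow> y \<in> {0..1} \<Longrightarrow> \<bar>x - y\<bar> \<le> rho n \<Longrightarrow> \<bar>w x - w y\<bar> \<le> C * amp (Suc n)"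
        by blast
      have "hausdorff_dim (graph01 f) = s"
      proof (rule hausdorff_dim_eqI)
        fix t assume t: "s < t"
        have "hnull t (graph01 w)"
        \<comment> \<open>The zero function is not in \<open>H_s s\<close>, but its graph is a
          segment, null above dimension 1.\<close>
        proof (cases "w = 0")
          case True
          then have "w = fscale 0 ident01" by (simp add: fun_eq_iff)
          then show ?thesis using hnull_graph_line[of t 0] t s by simp
        next
          case False
          then have "w \<in> H_s s" using wF(1) B(3) by blast
          then show ?thesis using t by (intro hausdorff_dim_graph_less_imp_hnull) (auto simp: H_s_def)
        qed
        then show "hnull t (graph01 f)"
          unfolding wF(3) by (intro hnull_graph_add_Phi wC FC t V0_const[OF wF(2)])
      next
        fix t assume t: "0 \<le> t" "t < s"
        show "\<not> hnull t (graph01 f)"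
        proof (rule not_hnull_graph[OF i C(1) C(2)])
          show "(1::nat) \<le> Suc i" by simp
          show "{1 / real (M (Suc i))..2 / M (Suc i)} \<subseteq> {0..1}" using cell_subset[of i] by (simp add: cell_def)
          show "1 / real (M (Suc i)) < 2 / M (Suc i)" by (simp add: divide_strict_right_mono)
          fix u assume "u \<in> {1 / real (M (Suc i))..2 / M (Suc i)}"
          then have u: "u \<in> cell i" by (simp add: cell_def)
          then have u01: "u \<in> {0..1}" using cell_subset by blast
          show "f (pos u) = w (pos u) + a i * osc (Suc i) u"
            using a[OF pos_bounds[OF u01], of i] u by (simp add: wF(3) Phi_pos[OF u01] bump_cell)
        qed (use t in auto)
      qed (use s in simp)
      then show ?thesis using \<open>f \<in> V\<close> \<open>V \<subseteq> C01\<close> by (auto simp: H_s_def)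
    qed
  qed
  ultimately show ?thesis by blast
qed

end

section \<open>Choice of the scales and conclusion\<close>

lemma ex_cantor_scale:
  assumes s: "1 < s" "s \<le> 2" and B: "finite B" "B \<subseteq> C01"
  obtains M where "cantor_scale s M"
    "\<And>f n x y. f \<in> B \<Longrightarrow> 1 \<le> n \<Longrightarrow> x \<in> {0..1} \<Longrightarrow> y \<in> {0..1} \<Longrightarrow> \<bar>x - y\<bar> \<le> 1 / real (M n) \<Longrightarrow> \<bar>f x - f y\<bar> \<le> (1/2) ^ (Suc n)\<^sup>2"
proof -
  have "\<exists>d>0. \<forall>f\<in>B. \<forall>x\<in>{0..1}. \<forall>y\<in>{0..1}. \<bar>x - y\<bar> < d \<longrightarrow> \<bar>f x - f y\<bar> < (1/2) ^ (Suc n)\<^sup>2" for n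
    using B
  proof (induction B rule: finite_induct)
    case (insert f B)
    then obtain d where d: "d > 0" "\<forall>f\<in>B. \<forall>x\<in>{0..1}. \<forall>y\<in>{0..1}. \<bar>x - y\<bar> < d \<longrightarrow> \<bar>f x - f y\<bar> < (1/2) ^ (Suc n)\<^sup>2"
      by blast
    have "uniformly_continuous_on {0..1} f"
      using insert.prems by (intro compact_uniformly_continuous) (auto simp: C01_def)
    then obtain d' where d': "d' > 0" "\<forall>x\<in>{0..1}. \<forall>y\<in>{0..1}. dist y x < d' \<longrightarrow> dist (f y) (f x) < (1/2) ^ (Suc n)\<^sup>2"
      unfolding uniformly_continuous_on_def by (metis zero_less_power half_gt_zero zero_less_one)
    have "\<forall>x\<in>{0..1}. \<forall>y\<in>{0..1}. \<bar>x - y\<bar> < min d d' \<longrightarrow> \<bar>g x - g y\<bar> < (1/2) ^ (Suc n)\<^sup>2" if "g \<in> insert f B" for g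
      using that d(2) d'(2) by (auto simp: dist_real_def)
    then show ?case using d(1) d'(1) by (intro exI[of _ "min d d'"]) auto
  qed (auto intro: exI[of _ 1])
  then obtain d where d: "\<And>n. d n > 0"
    "\<And>f n x y. f \<in> B \<Longrightarrow> x \<in> {0..1} \<Longrightarrow> y \<in> {0..1} \<Longrightarrow> \<bar>x - y\<bar> < d n \<Longrightarrow> \<bar>f x - f y\<bar> < (1/2) ^ (Suc n)\<^sup>2"
    by metis
  \<comment> \<open>\<open>T n\<close> leads from level \<open>n\<close> to level
    \<open>n+1\<close>, so it carries the modulus \<open>d (n+1)\<close>; \<open>M 0 = 1\<close>
    satisfies none, hence the condition \<open>1 \<le> n\<close>.\<close>
  define T where "T n = 2 ^ ((n + 3) ^ 3) + nat \<lceil>1 / d (Suc n)\<rceil>" for n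
  define M where "M n = (\<Prod>i<n. T i)" for n
  have T_pos: "T n > 0" for n by (simp add: T_def)
  have M_pos: "M n > 0" for n using T_pos by (simp add: M_def prod_pos)
  have M_Suc: "M (Suc n) = M n * T n" for n by (simp add: M_def)
  have "cantor_scale s M"
  proof
    show "2 ^ ((n + 3) ^ 3) * M n \<le> M (Suc n)" for n unfolding M_Suc by (simp add: T_def)
  qed (use s M_pos M_Suc in auto)
  moreover have "1 / real (M n) < d n" if "1 \<le> n" for n
  proof -
    obtain m where m: "n = Suc m" using \<open>1 \<le> n\<close> not0_implies_Suc[of n] by auto
    have "1 / d n \<le> real (nat \<lceil>1 / d (Suc m)\<rceil>)" unfolding m by (rule real_nat_ceiling_ge)
    also have "\<dots> < real (T m)" by (simp add: T_def)
    also have "\<dots> \<le> real (M n)"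
    proof -
      have "1 * T m \<le> M m * T m" using M_pos[of m] by (intro mult_right_mono) auto
      then show ?thesis unfolding m M_Suc of_nat_le_iff by simp
    qed
    finally show ?thesis using d(1)[of n] M_pos[of n] by (simp add: field_simps)
  qed
  then have "\<bar>f x - f y\<bar> \<le> (1/2) ^ (Suc n)\<^sup>2"
    if "f \<in> B" "1 \<le> n" "x \<in> {0..1}" "y \<in> {0..1}" "\<bar>x - y\<bar> \<le> 1 / real (M n)" for f n x y
    using that d(2)[of f x y n] by force
  ultimately show ?thesis using that by blast
qed

lemma finite_dim_extension:
  assumes "1 < s" "s \<le> 2" "finite B" "B \<subseteq> C01" "fs.span B \<subseteq> H_s s \<union> {0}"
  obtains V where "lin_subspace V" "closed_C01 V" "has_dim V (UNIV :: real set)" "fs.span B \<subseteq> V" "V \<subseteq> H_s s \<union> {0}"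
proof -
  obtain M where M: "cantor_scale s M"
    "\<And>f n x y. f \<in> B \<Longrightarrow> 1 \<le> n \<Longrightarrow> x \<in> {0..1} \<Longrightarrow> y \<in> {0..1} \<Longrightarrow> \<bar>x - y\<bar> \<le> 1 / real (M n) \<Longrightarrow> \<bar>f x - f y\<bar> \<le> (1/2) ^ (Suc n)\<^sup>2"
    using ex_cantor_scale[OF assms(1-4)] by blast
  have "\<exists>V. lin_subspace V \<and> closed_C01 V \<and> has_dim V (UNIV :: real set) \<and> fs.span B \<subseteq> V \<and> V \<subseteq> H_s s \<union> {0}"
    by (rule cantor_scale.spaceable_extension[OF M(1) assms(3-5)]) (rule M(2))
  then show ?thesis by (elim exE conjE) (rule that)
qed

lemma lineable_finite:
  assumes "1 < s" "s \<le> 2"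
  shows "lineable (H_s s) {..<p::nat}"
proof -
  \<comment> \<open>Extending the zero space already yields an infinite-dimensional subspace, from
    which \<open>p\<close> basis elements are taken.\<close>
  obtain V where V: "lin_subspace V" "has_dim V (UNIV :: real set)" "V \<subseteq> H_s s \<union> {0}"
    using finite_dim_extension[OF assms, of "{}"] by auto
  then obtain B where B: "B \<subseteq> V" "fs.independent B" "B \<approx> (UNIV :: real set)"
    unfolding has_dim_def by blast
  have "infinite B" using B(3) eqpoll_finite_iff infinite_UNIV_char_0 by blast
  then obtain B' where B': "B' \<subseteq> B" "finite B'" "card B' = p" using infinite_arbitrarily_large by blast
  have span: "fs.span B' \<subseteq> V" using V(1) B B' by (intro fs.span_minimal) (auto simp: lin_subspace_def)
  then have "lin_subspace (fs.span B')" using V(1) by (auto simp: lin_subspace_def)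
  moreover have "has_dim (fs.span B') {..<p}"
    unfolding has_dim_def using B' fs.independent_mono[OF B(2) B'(1)] fs.span_superset
    by (intro exI[of _ B']) (auto simp: eqpoll_iff_card)
  ultimately show ?thesis unfolding lineable_def using span V(3) by blast
qed

lemma spaceable_finite:
  assumes "1 < s" "s \<le> 2"
  shows "spaceable (H_s s) {..<p::nat} (UNIV :: real set)"
  unfolding spaceable_def
proof (intro conjI allI impI)
  show "lineable (H_s s) {..<p}" by (rule lineable_finite[OF assms])
  fix W assume "lin_subspace W \<and> has_dim W {..<p} \<and> W \<subseteq> H_s s \<union> {0}"
  then have W: "lin_subspace W" "W \<subseteq> H_s s \<union> {0}" "has_dim W {..<p}" by simp_all
  from W(3) obtain B where "B \<subseteq> W" "fs.span B = W" "B \<approx> {..<p}"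
    unfolding has_dim_def by blast
  note B = W(1,2) this
  have "finite B" using B(5) eqpoll_finite_iff by blast
  moreover have "B \<subseteq> C01" using B(1,3) by (auto simp: lin_subspace_def)
  moreover have "fs.span B \<subseteq> H_s s \<union> {0}" using B(2,4) by simp
  ultimately obtain V where "lin_subspace V" "closed_C01 V" "has_dim V (UNIV :: real set)" "fs.span B \<subseteq> V" "V \<subseteq> H_s s \<union> {0}"
    by (rule finite_dim_extension[OF assms])
  then show "\<exists>V. lin_subspace V \<and> closed_C01 V \<and> has_dim V (UNIV :: real set) \<and> W \<subseteq> V \<and> V \<subseteq> H_s s \<union> {0}"
    using B(4) by blast
qed

theorem theorem3p15:
  fixes s :: real and p :: nat and A :: "'a set"
  assumes "1 < s" and "s \<le> 2" and "infinite A" and "p \<in> {1, 2}"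
  shows "spaceable (H_s s) {..<p} (UNIV :: real set)
         \<and> (\<forall>B :: 'b set. A \<prec> B \<longrightarrow> \<not> spaceable (H_s s) A B)"
  using spaceable_finite[OF assms(1,2)] not_spaceable_infinite_dim[OF assms(1,3)] by blast

end
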